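(* Let $C$ be a bounded rational polyhedral subset of $\mathbb{R}^n$ and let $f:C\to\mathbb{R}$ be a continuous convex function. Then $f$ is integral polyhedral if and only if $f(x)\in\mathbb{Z}+\mathbb{Z}x_1+\cdots+\mathbb{Z}x_n$ for all $x=(x_1,\dots,x_n)\in C\cap\mathbb{Q}^n$.
   Context: An integral affine functional is $\lambda(x)=a_1x_1+\cdots+a_nx_n+b$ with $a_i,b\in\mathbb{Z}$; an integral generalized affine functional is either such a functional or such a functional plus the indicator function $\delta_H$ (equal to $0$ on $H$, $+\infty$ off $H$) of a closed half-space $H=\{a_1x_1+\cdots+a_nx_n\le b\}$ with $a_i,b\in\mathbb{Z}$ not all $a_i$ zero. A function $\mathbb{R}^n\to\mathbb{R}\cup\{+\infty\}$ is integral polyhedral if it is the maximum of finitely many integral generalized affine functionals; a set $C$ is rational polyhedral if $\delta_C$ is integral polyhedral. A function $f:C\to\mathbb{R}$ is convex (resp. integral polyhedral) if its extension by $+\infty$ outside $C$ is convex (resp. integral polyhedral). *)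

theory Defs
  imports "HOL-Analysis.Analysis"
begin

definition integral_affine :: "(real ^ 'n \<Rightarrow> real) \<Rightarrow> bool" where
  "integral_affine l \<longleftrightarrow>
     (\<exists>(a :: int ^ 'n) (b :: int). l = (\<lambda>x. (\<Sum>i\<in>UNIV. of_int (a $ i) * x $ i) + of_int b))"

definition integral_half_space :: "(real ^ 'n) set \<Rightarrow> bool" where
  "integral_half_space H \<longleftrightarrow>
     (\<exists>(a :: int ^ 'n) (b :: int). a \<noteq> 0 \<and>
        H = {x. (\<Sum>i\<in>UNIV. of_int (a $ i) * x $ i) \<le> of_int b})"

text \<open>The indicator function in the sense of convex analysis.\<close>

definition delta :: "'a set \<Rightarrow> 'a \<Rightarrow> ereal" where
  "delta H x = (if x \<in> H then 0 else \<infinity>)"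

definition integral_gen_affine :: "(real ^ 'n \<Rightarrow> ereal) \<Rightarrow> bool" where
  "integral_gen_affine g \<longleftrightarrow>
     (\<exists>l. integral_affine l \<and> g = (\<lambda>x. ereal (l x))) \<or>
     (\<exists>l H. integral_affine l \<and> integral_half_space H \<and> g = (\<lambda>x. ereal (l x) + delta H x))"

text \<open>
  Functions with values in the reals extended by \<open>+\<infinity>\<close> are rendered as \<^typ>\<open>ereal\<close>-valued functions.
  The family over which the maximum is taken is nonempty, so that the value \<open>-\<infinity>\<close> does not occur.
\<close>

definition integral_polyhedral :: "(real ^ 'n \<Rightarrow> ereal) \<Rightarrow> bool" where
  "integral_polyhedral g \<longleftrightarrow>
     (\<exists>G. finite G \<and> G \<noteq> {} \<and> (\<forall>h\<in>G. integral_gen_affine h) \<and> g = (\<lambda>x. MAX h\<in>G. h x))"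

definition rational_polyhedral :: "(real ^ 'n) set \<Rightarrow> bool" where
  "rational_polyhedral C \<longleftrightarrow> integral_polyhedral (delta C)"

text \<open>Jensen's inequality; with \<open>0 < t < 1\<close> no product of \<open>0\<close> and \<open>\<infinity>\<close> arises.\<close>

definition ereal_convex :: "('a::real_vector \<Rightarrow> ereal) \<Rightarrow> bool" where
  "ereal_convex g \<longleftrightarrow>
     (\<forall>x y. \<forall>t::real. 0 < t \<and> t < 1 \<longrightarrow>
        g ((1 - t) *\<^sub>R x + t *\<^sub>R y) \<le> ereal (1 - t) * g x + ereal t * g y)"

text \<open>
  A real function on \<open>C\<close> is a total function whose values outside \<open>C\<close> are disregarded.
\<close>

definition extend_infty :: "'a set \<Rightarrow> ('a \<Rightarrow> real) \<Rightarrow> 'a \<Rightarrow> ereal" where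
  "extend_infty C f x = (if x \<in> C then ereal (f x) else \<infinity>)"

definition convex_fun_on :: "'a::real_vector set \<Rightarrow> ('a \<Rightarrow> real) \<Rightarrow> bool" where
  "convex_fun_on C f \<longleftrightarrow> ereal_convex (extend_infty C f)"

definition integral_polyhedral_on :: "(real ^ 'n) set \<Rightarrow> (real ^ 'n \<Rightarrow> real) \<Rightarrow> bool" where
  "integral_polyhedral_on C f \<longleftrightarrow> integral_polyhedral (extend_infty C f)"

end

theory Submission
  imports Defs
begin

text \<open>
  Homogenize: for \<open>D = {(u, s). s > 0 \<and> u / s \<in> C}\<close> in \<open>\<int>\<^sup>n\<^sup>+\<^sup>1\<close> put
  \<open>F (u, s) = s f (u / s)\<close>. The condition on the values of \<open>f\<close> says that \<open>F\<close> is integer valued, and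
  convexity of \<open>f\<close> says that \<open>F\<close> is sublinear. A directional derivative of \<open>F\<close> at a lattice point
  \<open>p\<close> in the relative interior is the limit of the decreasing integers \<open>F (k p + v) - k F p\<close>, hence
  again integer valued; it is sublinear, lies below \<open>F\<close> and is linear along \<open>p\<close>. Iterating over finitely
  many directions produces a linear integer valued minorant that agrees with \<open>F\<close> at \<open>p\<close>, that is, an
  integral affine functional below \<open>f\<close> touching \<open>f\<close> at a given rational point of the relative
  interior of \<open>C\<close>. Finitely many of these suffice: on \<open>C\<close> a functional is controlled by its values at the
  rational vertices, which lie in a common lattice and are bounded above by \<open>f\<close>, so Dickson's
  lemma applies. Continuity extends the equality to all of \<open>C\<close>.
\<close>

section \<open>Integer linear functionals on subgroups of lattices\<close>

interpretation int_vec: module "(*s) :: int \<Rightarrow> int ^ 'm \<Rightarrow> int ^ 'm"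
  by standard (simp_all add: vec_eq_iff algebra_simps)

definition int_linear_on :: "(int ^ 'm) set \<Rightarrow> (int ^ 'm \<Rightarrow> int) \<Rightarrow> bool" where
  "int_linear_on L l \<longleftrightarrow>
     (\<forall>x\<in>L. \<forall>y\<in>L. l (x + y) = l x + l y) \<and> (\<forall>k. \<forall>x\<in>L. l (k *s x) = k * l x)"

definition int_dot :: "int ^ 'm \<Rightarrow> int ^ 'm \<Rightarrow> int" where
  "int_dot a v = (\<Sum>i\<in>UNIV. a $ i * v $ i)"

lemma int_dot_add_left: "int_dot (a + b) v = int_dot a v + int_dot b v"
  by (simp add: int_dot_def algebra_simps sum.distrib)

lemma int_dot_add_right: "int_dot a (v + w) = int_dot a v + int_dot a w"
  by (simp add: int_dot_def algebra_simps sum.distrib)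

lemma int_dot_scale_right: "int_dot a (k *s v) = k * int_dot a v"
  by (simp add: int_dot_def algebra_simps sum_distrib_left)

text \<open>Modulo \<open>d\<close>, \<open>T\<close> is the graph of a homomorphism from a subgroup
  of Z/d into Z/d; the divisibility hypothesis says that it is well defined. Such a homomorphism is
  multiplication by a constant, because Z/d is self-injective.\<close>

lemma ex_multiplier_mod:
  fixes T :: "(int \<times> int) set" and d :: int
  assumes d: "d > 0" and zero: "(0, 0) \<in> T"
    and closed: "\<And>x y x' y' k. (x, y) \<in> T \<Longrightarrow> (x', y') \<in> T \<Longrightarrow> (x - k * x', y - k * y') \<in> T"
    and dvd: "\<And>x y. (x, y) \<in> T \<Longrightarrow> d dvd x \<Longrightarrow> d dvd y"
  shows "\<exists>c. \<forall>(x, y)\<in>T. d dvd y - c * x"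
proof -
  \<comment> \<open>The least such number is the generator \<open>g\<close> of the ideal spanned by
    \<open>d\<close> and all first coordinates, so it divides each of them.\<close>
  define P where "P n \<longleftrightarrow> n > 0 \<and> (\<exists>x y k. (x, y) \<in> T \<and> int n = x + d * k)" for n :: nat
  have "P (nat d)"
    unfolding P_def using d zero by (intro conjI exI[of _ 0] exI[of _ 1]) auto
  then have P: "P (LEAST n. P n)" and least: "\<And>n. P n \<Longrightarrow> (LEAST n. P n) \<le> n"
    by (auto intro: LeastI Least_le)
  define g where "g = int (LEAST n. P n)"
  obtain x0 y0 k0 where g: "g > 0" and T0: "(x0, y0) \<in> T" and gx: "g = x0 + d * k0"
    using P unfolding P_def g_def by auto
  have g_dvd: "g dvd x + d * k" if "(x, y) \<in> T" for x y k
  proof -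
    define r where "r = (x + d * k) mod g"
    have r: "r = (x - ((x + d * k) div g) * x0) + d * (k - ((x + d * k) div g) * k0)"
      unfolding r_def minus_div_mult_eq_mod[symmetric] by (simp add: gx algebra_simps)
    have "\<not> r > 0"
    proof
      assume "r > 0"
      then have "P (nat r)"
        unfolding P_def using r closed[OF that T0] by auto
      then have "g \<le> r"
        using least \<open>r > 0\<close> unfolding g_def by fastforce
      then show False
        using g unfolding r_def by (meson not_le pos_mod_bound)
    qed
    moreover have "r \<ge> 0"
      using g by (simp add: r_def)
    ultimately have "r = 0" by simp
    then show ?thesis by (auto simp: r_def)
  qed
  obtain e where e: "d = g * e"
    using g_dvd[OF zero, of 1] by (auto elim: dvdE)
  have "e \<noteq> 0" using d e by auto
  \<comment> \<open>The first coordinate of \<open>e\<close> times \<open>(x0, y0)\<close> is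
    divisible by \<open>d = g * e\<close>, hence so is \<open>e * y0\<close>. Cancelling
    \<open>e\<close> gives an integer \<open>c = y0 / g\<close>, the multiplier sought.\<close>
  have "(0 - (- e) * x0, 0 - (- e) * y0) \<in> T"
    by (rule closed[OF zero T0])
  moreover have "e * x0 = d * (1 - k0 * e)"
  proof -
    have x0: "x0 = g - d * k0" using gx by simp
    show ?thesis unfolding x0 e by (simp add: algebra_simps)
  qed
  ultimately have "e * g dvd e * y0"
    using dvd by (fastforce simp: e mult.commute)
  then have "g dvd y0"
    using \<open>e \<noteq> 0\<close> by simp
  then obtain c where c: "y0 = g * c" ..
  have "d dvd y - c * x" if T: "(x, y) \<in> T" for x y
  proof -
    obtain t where t: "x = g * t"
      using g_dvd[OF T, of 0] by (auto elim: dvdE)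
    have "(x - t * x0, y - t * y0) \<in> T"
      by (rule closed[OF T T0])
    moreover have "x - t * x0 = d * (k0 * t)"
      unfolding t gx by (simp add: algebra_simps)
    ultimately have "d dvd y - t * y0"
      using dvd by fastforce
    moreover have "y - t * y0 = y - c * x"
      by (simp add: t c algebra_simps)
    ultimately show ?thesis by simp
  qed
  then show ?thesis by blast
qed

text \<open>The coefficients are found one coordinate at a time: for growing \<open>J\<close>,
  \<open>l\<close> is matched modulo \<open>d\<close> on those members of \<open>L\<close> whose
  coordinates outside \<open>J\<close> are divisible by \<open>d\<close>. For \<open>J\<close> empty
  this is the divisibility hypothesis, for \<open>J = UNIV\<close> the claim.\<close>

lemma int_linear_on_lift_mod:
  fixes L :: "(int ^ 'm) set"
  assumes L: "int_vec.subspace L" and l: "int_linear_on L l" and d: "d > 0"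
    and dvd: "\<And>v. v \<in> L \<Longrightarrow> (\<And>i. d dvd v $ i) \<Longrightarrow> d dvd l v"
  shows "\<exists>a. \<forall>v\<in>L. d dvd l v - int_dot a v"
proof -
  have "\<exists>a. \<forall>v\<in>L. (\<forall>i\<in>-J. d dvd v $ i) \<longrightarrow> d dvd l v - (\<Sum>i\<in>J. a i * v $ i)"
    for J :: "'m set"
  proof (induction J rule: finite_induct[OF finite])
    case 1
    then show ?case using dvd by auto
  next
    case (2 j J)
    then obtain a where a: "\<And>v. v \<in> L \<Longrightarrow> \<forall>i\<in>-J. d dvd v $ i \<Longrightarrow>
        d dvd l v - (\<Sum>i\<in>J. a i * v $ i)"
      by blast
    define m where "m v = l v - (\<Sum>i\<in>J. a i * v $ i)" for v
    define B where "B = {v\<in>L. \<forall>i\<in>-insert j J. d dvd v $ i}"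
    have m: "m (x - k *s y) = m x - k * m y" if "x \<in> L" "y \<in> L" for x y k
    proof -
      have "l (x + (- k) *s y) = l x + (- k) * l y"
        using l L that unfolding int_linear_on_def
        by (metis int_vec.subspace_scale)
      moreover have "x + (- k) *s y = x - k *s y"
        by simp
      ultimately have "l (x - k *s y) = l x - k * l y"
        by simp
      then show ?thesis
        by (simp add: m_def algebra_simps sum_subtractf sum_distrib_left)
    qed
    \<comment> \<open>The remainder \<open>m\<close> is divisible by \<open>d\<close> as soon as the
      coordinate \<open>j\<close> is, by the induction hypothesis, so modulo \<open>d\<close> it is
      a multiple of that coordinate.\<close>
    have "\<exists>c. \<forall>(x, y)\<in>(\<lambda>v. (v $ j, m v)) ` B. d dvd y - c * x"
    proof (rule ex_multiplier_mod[OF d])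
      have "0 \<in> B" "m 0 = 0"
        using L m[of 0 0 1] by (auto simp: B_def int_vec.subspace_0)
      then show "(0, 0) \<in> (\<lambda>v. (v $ j, m v)) ` B"
        by (force simp: image_iff)
    next
      fix x y x' y' k
      assume "(x, y) \<in> (\<lambda>v. (v $ j, m v)) ` B" "(x', y') \<in> (\<lambda>v. (v $ j, m v)) ` B"
      then obtain v w where vw: "v \<in> B" "w \<in> B" "x = v $ j" "y = m v" "x' = w $ j" "y' = m w"
        by auto
      have "v - k *s w \<in> B"
        using vw L by (auto simp: B_def int_vec.subspace_diff int_vec.subspace_scale)
      moreover have "m (v - k *s w) = m v - k * m w"
        using m vw by (auto simp: B_def)
      ultimately show "(x - k * x', y - k * y') \<in> (\<lambda>v. (v $ j, m v)) ` B"
        by (intro image_eqI[of _ _ "v - k *s w"]) (auto simp: vw)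
    next
      fix x y assume "(x, y) \<in> (\<lambda>v. (v $ j, m v)) ` B" "d dvd x"
      then show "d dvd y"
        using a by (fastforce simp: B_def m_def)
    qed
    then obtain c where c: "\<And>v. v \<in> B \<Longrightarrow> d dvd m v - c * v $ j"
      by auto
    have "(\<Sum>i\<in>insert j J. (a(j := c)) i * v $ i) = c * v $ j + (\<Sum>i\<in>J. a i * v $ i)" for v
      using 2 by (auto intro!: sum.cong)
    then have "\<forall>v\<in>L. (\<forall>i\<in>-insert j J. d dvd v $ i) \<longrightarrow>
        d dvd l v - (\<Sum>i\<in>insert j J. (a(j := c)) i * v $ i)"
      using c by (auto simp: B_def m_def algebra_simps)
    then show ?case by blast
  qed
  from this[of UNIV] obtain a where "\<forall>v\<in>L. d dvd l v - (\<Sum>i\<in>UNIV. a i * v $ i)"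
    by auto
  then show ?thesis
    by (intro exI[of _ "\<chi> i. a i"]) (simp add: int_dot_def)
qed

text \<open>One coordinate is eliminated at a time: if \<open>w $ j > 0\<close>, then
  \<open>w $ j *s v - v $ j *s w\<close> has coordinate \<open>j\<close> equal to zero, so
  \<open>l\<close> is determined by \<open>l w\<close> and its values on the kernel
  \<open>L0\<close> of that coordinate. The denominator is merely multiplied by
  \<open>w $ j\<close>; since \<open>w\<close> depends on \<open>L\<close> alone, it is uniform in
  \<open>l\<close>.\<close>

lemma int_linear_on_bounded_denominator:
  fixes L :: "(int ^ 'm) set"
  assumes "int_vec.subspace L"
  shows "\<exists>d>0. \<forall>l. int_linear_on L l \<longrightarrow> (\<exists>a. \<forall>v\<in>L. d * l v = int_dot a v)"
proof -
  have "\<exists>d>0. \<forall>l. int_linear_on L l \<longrightarrow> (\<exists>a. \<forall>v\<in>L. d * l v = (\<Sum>i\<in>J. a i * v $ i))"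
    if "int_vec.subspace L" "\<forall>v\<in>L. \<forall>i\<in>-J. v $ i = 0" for L and J :: "'m set"
    using finite[of J] that
  proof (induction J arbitrary: L rule: finite_induct)
    case empty
    have "l v = 0" if "int_linear_on L l" "v \<in> L" for l v
    proof -
      have "v = 0 *s v" using empty that by (auto simp: vec_eq_iff)
      then show ?thesis using that unfolding int_linear_on_def by (metis mult_zero_left)
    qed
    then show ?case by (intro exI[of _ 1]) auto
  next
    case (insert j J)
    define L0 where "L0 = {v\<in>L. v $ j = 0}"
    have "int_vec.subspace L0"
      using insert.prems by (auto simp: L0_def int_vec.subspace_def)
    moreover have "\<forall>v\<in>L0. \<forall>i\<in>-J. v $ i = 0"
      using insert.prems by (auto simp: L0_def)
    ultimately obtain d where d: "d > 0" and
      IH: "\<And>l. int_linear_on L0 l \<Longrightarrow> \<exists>a. \<forall>v\<in>L0. d * l v = (\<Sum>i\<in>J. a i * v $ i)"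
      using insert.IH[of L0] by blast
    have lin0: "int_linear_on L0 l" if "int_linear_on L l" for l
      using that by (auto simp: L0_def int_linear_on_def)
    have upd: "(\<Sum>i\<in>insert j J. ((\<lambda>i. u * a i)(j := c)) i * v $ i) = c * v $ j + u * (\<Sum>i\<in>J. a i * v $ i)"
      for a c u and v :: "int ^ 'm"
      using insert.hyps by (auto intro!: sum.cong simp: sum_distrib_left mult.assoc)
    show ?case
    proof (cases "L0 = L")
      case True
      have "\<exists>a. \<forall>v\<in>L. d * l v = (\<Sum>i\<in>insert j J. a i * v $ i)" if l: "int_linear_on L l" for l
      proof -
        obtain a where "\<forall>v\<in>L. d * l v = (\<Sum>i\<in>J. a i * v $ i)"
          using IH[OF lin0[OF l]] True by auto
        then have "\<forall>v\<in>L. d * l v = (\<Sum>i\<in>insert j J. ((\<lambda>i. 1 * a i)(j := 0)) i * v $ i)"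
          unfolding upd by simp
        then show ?thesis by blast
      qed
      then show ?thesis using d by blast
    next
      case False
      then obtain w0 where w0: "w0 \<in> L" "w0 $ j \<noteq> 0" by (auto simp: L0_def)
      define w where "w = (sgn (w0 $ j)) *s w0"
      have w: "w \<in> L" "w $ j > 0"
        using w0 insert.prems by (auto simp: w_def int_vec.subspace_scale linorder_neq_iff sgn_if)
      have "\<exists>a. \<forall>v\<in>L. (d * w $ j) * l v = (\<Sum>i\<in>insert j J. a i * v $ i)"
        if l: "int_linear_on L l" for l
      proof -
        obtain a where a: "\<And>v. v \<in> L0 \<Longrightarrow> d * l v = (\<Sum>i\<in>J. a i * v $ i)"
          using IH[OF lin0[OF l]] by auto
        define s where "s v = (\<Sum>i\<in>J. a i * v $ i)" for v :: "int ^ 'm"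
        have eq: "(d * w $ j) * l v = (d * l w - s w) * v $ j + w $ j * s v" if v: "v \<in> L" for v
        proof -
          have mem: "w $ j *s v \<in> L" "(- v $ j) *s w \<in> L"
            using v w insert.prems by (blast intro: int_vec.subspace_scale)+
          have "w $ j *s v + (- v $ j) *s w \<in> L"
            using insert.prems mem by (blast intro: int_vec.subspace_add)
          then have "w $ j *s v + (- v $ j) *s w \<in> L0"
            by (simp add: L0_def)
          then have "d * l (w $ j *s v + (- v $ j) *s w) = s (w $ j *s v + (- v $ j) *s w)"
            using a by (simp add: s_def)
          moreover have "l (w $ j *s v + (- v $ j) *s w) = w $ j * l v + (- v $ j) * l w"
            using l mem v w unfolding int_linear_on_def by metis
          moreover have "s (w $ j *s v + (- v $ j) *s w) = w $ j * s v - v $ j * s w"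
            by (simp add: s_def algebra_simps sum.distrib sum_subtractf sum_distrib_left)
          ultimately have "d * (w $ j * l v + (- v $ j) * l w) = w $ j * s v - v $ j * s w"
            by simp
          then show ?thesis by (simp add: algebra_simps)
        qed
        show ?thesis
        proof (intro exI ballI)
          fix v assume "v \<in> L"
          show "(d * w $ j) * l v =
            (\<Sum>i\<in>insert j J. ((\<lambda>i. w $ j * a i)(j := d * l w - s w)) i * v $ i)"
            by (rule trans[OF eq[OF \<open>v \<in> L\<close>, unfolded s_def[of v]] upd[symmetric]])
        qed
      qed
      then show ?thesis using d w by (intro exI[of _ "d * w $ j"]) auto
    qed
  qed
  from this[OF assms, of UNIV] obtain d where "d > 0" and
    d: "\<And>l. int_linear_on L l \<Longrightarrow> \<exists>a. \<forall>v\<in>L. d * l v = (\<Sum>i\<in>UNIV. a i * v $ i)"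
    by auto
  have "\<exists>a. \<forall>v\<in>L. d * l v = int_dot a v" if "int_linear_on L l" for l
  proof -
    obtain a where "\<forall>v\<in>L. d * l v = (\<Sum>i\<in>UNIV. a i * v $ i)" using d[OF \<open>int_linear_on L l\<close>] by blast
    then show ?thesis by (intro exI[of _ "\<chi> i. a i"]) (simp add: int_dot_def)
  qed
  then show ?thesis using \<open>d > 0\<close> by blast
qed

text \<open>Once \<open>l\<close> agrees modulo \<open>d\<close> with some \<open>int_dot a\<close>, the difference is \<open>d\<close> times an integer valued
  functional, and a uniform \<open>d\<close> clears all denominators of its extension.\<close>

lemma int_linear_on_extend:
  fixes L :: "(int ^ 'm) set"
  assumes L: "int_vec.subspace L" and l: "int_linear_on L l"
    and sat: "\<And>k v. k > 0 \<Longrightarrow> k *s v \<in> L \<Longrightarrow> v \<in> L"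
  shows "\<exists>a. \<forall>v\<in>L. l v = int_dot a v"
proof -
  obtain d where d: "d > 0" and
    ext: "\<And>l. int_linear_on L l \<Longrightarrow> \<exists>a. \<forall>v\<in>L. d * l v = int_dot a v"
    using int_linear_on_bounded_denominator[OF L] by blast
  have "d dvd l v" if "v \<in> L" and dvd: "\<And>i. d dvd v $ i" for v
  proof -
    define u where "u = (\<chi> i. v $ i div d)"
    have v: "v = d *s u"
      using dvd by (simp add: u_def vec_eq_iff)
    then have "u \<in> L"
      using sat d \<open>v \<in> L\<close> by blast
    then show ?thesis
      using l v unfolding int_linear_on_def by simp
  qed
  then obtain a where a: "\<And>v. v \<in> L \<Longrightarrow> d dvd l v - int_dot a v"
    using int_linear_on_lift_mod[OF L l d] by blast
  define m where "m v = (l v - int_dot a v) div d" for v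
  have m: "d * m v = l v - int_dot a v" if "v \<in> L" for v
    using a[OF that] by (simp add: m_def)
  have "int_linear_on L m"
    unfolding int_linear_on_def
  proof (intro conjI ballI allI)
    fix x y assume xy: "x \<in> L" "y \<in> L"
    then have "l (x + y) = l x + l y" "x + y \<in> L"
      using l L by (auto simp: int_linear_on_def int_vec.subspace_add)
    then have "d * m (x + y) = d * (m x + m y)"
      using m[of x] m[of y] m[of "x + y"] xy by (simp add: distrib_left int_dot_add_right)
    then show "m (x + y) = m x + m y" using d by simp
  next
    fix k x assume x: "x \<in> L"
    then have "l (k *s x) = k * l x" "k *s x \<in> L"
      using l L by (auto simp: int_linear_on_def int_vec.subspace_scale)
    moreover have "k * (d * m x) = k * l x - k * int_dot a x"
      unfolding m[OF x] by (simp add: right_diff_distrib)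
    ultimately have "d * m (k *s x) = k * (d * m x)"
      using m[of "k *s x"] by (simp add: int_dot_scale_right)
    then show "m (k *s x) = k * m x" using d by simp
  qed
  then obtain b where b: "\<And>v. v \<in> L \<Longrightarrow> d * m v = int_dot b v"
    using ext by blast
  have "\<forall>v\<in>L. l v = int_dot (a + b) v"
  proof
    fix v assume "v \<in> L"
    then show "l v = int_dot (a + b) v"
      using m[of v] b[of v] by (simp add: int_dot_add_left)
  qed
  then show ?thesis by blast
qed

text \<open>A finite \<open>Q\<close> that spans \<open>L\<close> over the rationals is built by the
  same elimination of coordinates. It serves to show that a sublinear function which is odd on
  finitely many directions is odd, hence linear, on all of \<open>L\<close>.\<close>

lemma int_subspace_finite_rank:
  fixes L :: "(int ^ 'm) set"
  assumes "int_vec.subspace L"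
  shows "\<exists>Q\<subseteq>L. finite Q \<and> (\<forall>B. int_vec.subspace B \<longrightarrow> Q \<subseteq> B \<longrightarrow> B \<subseteq> L \<longrightarrow>
    (\<forall>k>0. \<forall>v\<in>L. k *s v \<in> B \<longrightarrow> v \<in> B) \<longrightarrow> B = L)"
proof -
  have "\<exists>Q\<subseteq>L. finite Q \<and> (\<forall>B. int_vec.subspace B \<longrightarrow> Q \<subseteq> B \<longrightarrow>
      (\<forall>k>0. \<forall>v\<in>L. k *s v \<in> B \<longrightarrow> v \<in> B) \<longrightarrow> L \<subseteq> B)"
    if "int_vec.subspace L" "\<forall>v\<in>L. \<forall>i\<in>-J. v $ i = 0" for L and J :: "'m set"
    using finite[of J] that
  proof (induction J arbitrary: L rule: finite_induct)
    case empty
    then have "L \<subseteq> {0}" by (auto simp: vec_eq_iff)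
    then show ?case
      by (intro exI[of _ "{}"]) (auto simp: int_vec.subspace_0)
  next
    case (insert j J)
    define L0 where "L0 = {v\<in>L. v $ j = 0}"
    have "int_vec.subspace L0"
      using insert.prems by (auto simp: L0_def int_vec.subspace_def)
    moreover have "\<forall>v\<in>L0. \<forall>i\<in>-J. v $ i = 0"
      using insert.prems by (auto simp: L0_def)
    ultimately obtain Q where Q: "Q \<subseteq> L0" "finite Q" and
      IH: "\<And>B. int_vec.subspace B \<Longrightarrow> Q \<subseteq> B \<Longrightarrow>
        (\<And>k v. k > 0 \<Longrightarrow> v \<in> L0 \<Longrightarrow> k *s v \<in> B \<Longrightarrow> v \<in> B) \<Longrightarrow> L0 \<subseteq> B"
      using insert.IH[of L0] by metis
    show ?case
    proof (cases "L0 = L")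
      case True
      then show ?thesis using Q IH by (intro exI[of _ Q]) auto
    next
      case False
      then obtain w0 where w0: "w0 \<in> L" "w0 $ j \<noteq> 0" by (auto simp: L0_def)
      define w where "w = (sgn (w0 $ j)) *s w0"
      have w: "w \<in> L" "w $ j > 0"
        using w0 insert.prems by (auto simp: w_def int_vec.subspace_scale linorder_neq_iff sgn_if)
      have "L \<subseteq> B" if B: "int_vec.subspace B" "insert w Q \<subseteq> B"
        and sat: "\<And>k v. k > 0 \<Longrightarrow> v \<in> L \<Longrightarrow> k *s v \<in> B \<Longrightarrow> v \<in> B" for B
      proof
        fix v assume v: "v \<in> L"
        have "L0 \<subseteq> B"
          using IH[of B] B sat by (auto simp: L0_def)
        moreover have "w $ j *s v - v $ j *s w \<in> L0"
          using insert.prems v w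
          by (auto simp: L0_def intro!: int_vec.subspace_diff int_vec.subspace_scale)
        moreover have "v $ j *s w \<in> B"
          using B by (auto intro: int_vec.subspace_scale)
        ultimately have "w $ j *s v - v $ j *s w + v $ j *s w \<in> B"
          using B by (blast intro: int_vec.subspace_add)
        then show "v \<in> B" using sat v w by simp
      qed
      then show ?thesis
        using Q w by (intro exI[of _ "insert w Q"]) (auto simp: L0_def)
    qed
  qed
  from this[OF assms, of UNIV] obtain Q where "Q \<subseteq> L" "finite Q"
    "\<forall>B. int_vec.subspace B \<longrightarrow> Q \<subseteq> B \<longrightarrow> (\<forall>k>0. \<forall>v\<in>L. k *s v \<in> B \<longrightarrow> v \<in> B) \<longrightarrow> L \<subseteq> B"
    by auto
  then show ?thesis by (intro exI[of _ Q]) blast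
qed

section \<open>Integer valued sublinear functions\<close>

definition int_sublinear_on :: "(int ^ 'm) set \<Rightarrow> (int ^ 'm \<Rightarrow> int) \<Rightarrow> bool" where
  "int_sublinear_on D F \<longleftrightarrow>
     (\<forall>x\<in>D. \<forall>y\<in>D. x + y \<in> D \<and> F (x + y) \<le> F x + F y) \<and>
     (\<forall>x\<in>D. \<forall>k>0. k *s x \<in> D \<and> F (k *s x) = k * F x)"

text \<open>The subgroup generated by \<open>D\<close>, when \<open>p\<close> is an order unit of \<open>D\<close>.\<close>

definition recession_span :: "(int ^ 'm) set \<Rightarrow> int ^ 'm \<Rightarrow> (int ^ 'm) set" where
  "recession_span D p = {v. \<exists>k>0. k *s p + v \<in> D}"

section \<open>Directional derivatives at an order unit\<close>

lemma int_sublinear_onD: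
  assumes "int_sublinear_on D F"
  shows "x \<in> D \<Longrightarrow> y \<in> D \<Longrightarrow> x + y \<in> D" "x \<in> D \<Longrightarrow> y \<in> D \<Longrightarrow> F (x + y) \<le> F x + F y"
    "x \<in> D \<Longrightarrow> k > 0 \<Longrightarrow> k *s x \<in> D" "x \<in> D \<Longrightarrow> k > 0 \<Longrightarrow> F (k *s x) = k * F x"
  using assms by (auto simp: int_sublinear_on_def)

text \<open>Closure under negation comes from the order unit: if \<open>k *s p + v\<close> lies in
  \<open>D\<close>, then so does \<open>j *s p - (k *s p + v)\<close> for some \<open>j\<close>, and
  adding \<open>k *s p\<close> leaves \<open>j *s p - v\<close>.\<close>

lemma subspace_recession_span:
  assumes F: "int_sublinear_on D F" and p: "p \<in> D"
    and unit: "\<And>v. v \<in> D \<Longrightarrow> \<exists>k>0. k *s p - v \<in> D"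
  shows "int_vec.subspace (recession_span D p)"
proof -
  let ?L = "recession_span D p"
  have zero: "0 \<in> ?L"
    using p by (auto simp: recession_span_def intro: exI[of _ 1])
  have add: "v + w \<in> ?L" if vw: "v \<in> ?L" "w \<in> ?L" for v w
  proof -
    obtain k j where "k > 0" "k *s p + v \<in> D" "j > 0" "j *s p + w \<in> D"
      using vw by (auto simp: recession_span_def)
    then have "(k *s p + v) + (j *s p + w) \<in> D" "k + j > 0"
      using int_sublinear_onD(1)[OF F] by (blast, simp)
    moreover have "(k *s p + v) + (j *s p + w) = (k + j) *s p + (v + w)"
      by (simp add: vec_eq_iff algebra_simps)
    ultimately show ?thesis by (auto simp: recession_span_def)
  qed
  have neg: "- v \<in> ?L" if v: "v \<in> ?L" for v
  proof -
    obtain k where k: "k > 0" "k *s p + v \<in> D"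
      using v by (auto simp: recession_span_def)
    then obtain j where j: "j > 0" "j *s p - (k *s p + v) \<in> D"
      using unit by blast
    then have "(j *s p - (k *s p + v)) + k *s p \<in> D"
      using int_sublinear_onD(1)[OF F] int_sublinear_onD(3)[OF F p] k(1) by blast
    moreover have "(j *s p - (k *s p + v)) + k *s p = j *s p + - v"
      by (simp add: vec_eq_iff algebra_simps)
    ultimately show ?thesis using j by (auto simp: recession_span_def)
  qed
  have pos: "k *s v \<in> ?L" if v: "v \<in> ?L" and k: "k > 0" for k v
  proof -
    obtain j where "j > 0" "j *s p + v \<in> D"
      using v by (auto simp: recession_span_def)
    then have "k *s (j *s p + v) \<in> D" "k * j > 0"
      using int_sublinear_onD(3)[OF F] k by (blast, simp)
    moreover have "k *s (j *s p + v) = (k * j) *s p + k *s v"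
      by (simp add: vec_eq_iff algebra_simps)
    ultimately show ?thesis by (auto simp: recession_span_def)
  qed
  have "k *s v \<in> ?L" if v: "v \<in> ?L" for k v
  proof (cases k "0::int" rule: linorder_cases)
    case less
    then show ?thesis using neg[OF pos[OF v, of "- k"]] by simp
  next
    case equal
    then show ?thesis using zero by simp
  next
    case greater
    then show ?thesis using pos v by simp
  qed
  then show ?thesis
    using zero add by (auto simp: int_vec.subspace_def)
qed

text \<open>Adding \<open>k - 1\<close> further copies of \<open>j *s p\<close> to
  \<open>j *s p + k *s v\<close> gives \<open>k *s (j *s p + v)\<close>, to which saturation of
  \<open>D\<close> applies.\<close>

lemma recession_span_saturated:
  assumes F: "int_sublinear_on D F" and p: "p \<in> D"
    and sat: "\<And>k v. k > 0 \<Longrightarrow> k *s v \<in> D \<Longrightarrow> v \<in> D"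
    and k: "k > 0" "k *s v \<in> recession_span D p"
  shows "v \<in> recession_span D p"
proof -
  obtain j where j: "j > 0" "j *s p + k *s v \<in> D"
    using k by (auto simp: recession_span_def)
  have "k *s (j *s p + v) \<in> D"
  proof (cases "k = 1")
    case True
    then show ?thesis using j by simp
  next
    case False
    then have "(j *s p + k *s v) + (k - 1) *s (j *s p) \<in> D"
      using int_sublinear_onD(1,3)[OF F] p j k by simp
    moreover have "(j *s p + k *s v) + (k - 1) *s (j *s p) = k *s (j *s p + v)"
      by (simp add: vec_eq_iff algebra_simps)
    ultimately show ?thesis by (simp only:)
  qed
  then have "j *s p + v \<in> D" using sat k by blast
  then show ?thesis using j by (auto simp: recession_span_def)
qed

text \<open>The integers \<open>F (k *s p + v) - k * F p\<close> decrease with \<open>k\<close> and are bounded below, so they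
  are eventually constant.\<close>

lemma eventually_int_directional_derivative:
  assumes F: "int_sublinear_on D F" and p: "p \<in> D"
    and unit: "\<And>v. v \<in> D \<Longrightarrow> \<exists>k>0. k *s p - v \<in> D"
    and v: "v \<in> recession_span D p"
  shows "\<exists>g. \<forall>\<^sub>F k in at_top. k *s p + v \<in> D \<and> F (k *s p + v) = k * F p + g"
proof -
  note FD = int_sublinear_onD[OF F]
  obtain k0 where k0: "k0 > 0" "k0 *s p + v \<in> D"
    using v by (auto simp: recession_span_def)
  have step: "(k + j) *s p + v \<in> D \<and> F ((k + j) *s p + v) \<le> F (k *s p + v) + j * F p"
    if "k *s p + v \<in> D" "j > 0" for k j
  proof -
    have eq: "(k + j) *s p + v = (k *s p + v) + j *s p"
      by (simp add: vec_eq_iff algebra_simps)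
    show ?thesis
      unfolding eq using FD(1,2)[of "k *s p + v" "j *s p"] FD(3,4)[OF p, of j] that by simp
  qed
  have mono: "k' *s p + v \<in> D \<and> F (k' *s p + v) - k' * F p \<le> F (k *s p + v) - k * F p"
    if "k *s p + v \<in> D" "k \<le> k'" for k k'
    using step[OF that(1), of "k' - k"] that by (cases "k = k'") (auto simp: algebra_simps)
  have "- v \<in> recession_span D p"
    using subspace_recession_span[OF F p unit] v int_vec.subspace_neg by blast
  then obtain j where j: "j > 0" "j *s p - v \<in> D"
    by (auto simp: recession_span_def)
  \<comment> \<open>The lower bound comes from subadditivity applied to
    \<open>(k *s p + v) + (j *s p - v) = (k + j) *s p\<close>.\<close>
  define b where "b = j * F p - F (j *s p - v)"
  have bound: "b \<le> F (k *s p + v) - k * F p" if "k *s p + v \<in> D" "k > 0" for k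
  proof -
    have "(k *s p + v) + (j *s p - v) = (k + j) *s p"
      by (simp add: vec_eq_iff algebra_simps)
    then show ?thesis
      using FD(2)[OF that(1) j(2)] FD(4)[OF p, of "k + j"] that j
      by (simp add: b_def algebra_simps)
  qed
  obtain k where k: "k \<ge> k0" and
    least: "\<And>k'. k' \<ge> k0 \<Longrightarrow> nat (F (k *s p + v) - k * F p - b) \<le> nat (F (k' *s p + v) - k' * F p - b)"
    using ex_has_least_nat[of "\<lambda>k. k \<ge> k0" k0 "\<lambda>k. nat (F (k *s p + v) - k * F p - b)"] by auto
  have "k' *s p + v \<in> D \<and> F (k' *s p + v) = k' * F p + (F (k *s p + v) - k * F p)"
    if "k' \<ge> k" for k'
  proof -
    have kD: "k *s p + v \<in> D" using mono k0 k by blast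
    have k'D: "k' *s p + v \<in> D" using mono k0 k that by fastforce
    have "F (k *s p + v) - k * F p \<le> F (k' *s p + v) - k' * F p"
      using least[of k'] bound[OF kD] bound[OF k'D] k k0 that by linarith
    then show ?thesis using mono[OF kD that] by linarith
  qed
  then show ?thesis unfolding eventually_at_top_linorder by blast
qed

text \<open>\<open>G v\<close> is the eventual value of \<open>F (k *s p + v) - k * F p\<close>. The
  gain over \<open>F\<close> is twofold: \<open>G\<close> lives on a whole group, and it is linear
  along \<open>p\<close>.\<close>

lemma ex_int_directional_derivative:
  assumes F: "int_sublinear_on D F" and p: "p \<in> D"
    and unit: "\<And>v. v \<in> D \<Longrightarrow> \<exists>k>0. k *s p - v \<in> D"
  shows "\<exists>G. int_sublinear_on (recession_span D p) G \<and> (\<forall>v\<in>D. G v \<le> F v) \<and>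
    G p = F p \<and> G (- p) = - F p"
proof -
  note FD = int_sublinear_onD[OF F]
  let ?L = "recession_span D p"
  have L: "int_vec.subspace ?L"
    by (rule subspace_recession_span[OF F p unit])
  have "\<forall>v\<in>?L. \<exists>g. \<forall>\<^sub>F k in at_top. k *s p + v \<in> D \<and> F (k *s p + v) = k * F p + g"
    using eventually_int_directional_derivative[OF F p unit] by blast
  from bchoice[OF this] obtain G where G: "\<And>v. v \<in> ?L \<Longrightarrow>
      \<forall>\<^sub>F k in at_top. k *s p + v \<in> D \<and> F (k *s p + v) = k * F p + G v"
    by blast
  have double: "filterlim (\<lambda>k. c * k) at_top at_top" if "c > 0" for c :: int
    unfolding filterlim_at_top_ge[of _ _ 1]
  proof (intro allI impI)
    fix Z :: int assume "1 \<le> Z"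
    have "Z \<le> c * k" if "k \<ge> Z" for k
      using \<open>c > 0\<close> \<open>1 \<le> Z\<close> that mult_mono[of 1 c Z k] by simp
    then show "\<forall>\<^sub>F k in at_top. Z \<le> c * k"
      unfolding eventually_at_top_linorder by blast
  qed
  \<comment> \<open>Evaluation at multiples of \<open>k\<close> matches
    \<open>(2 * k) *s p + (v + w)\<close> with a sum of two points for subadditivity, and
    \<open>(c * k) *s p + c *s v\<close> with \<open>c *s (k *s p + v)\<close> for
    homogeneity.\<close>
  have mult: "\<forall>\<^sub>F k in at_top. F ((c * k) *s p + v) = (c * k) * F p + G v"
    if "v \<in> ?L" "c > 0" for c v
    using eventually_compose_filterlim[OF G[OF that(1)] double[OF that(2)]]
    by (rule eventually_mono) simp
  have add: "G (v + w) \<le> G v + G w" if vw: "v \<in> ?L" "w \<in> ?L" for v w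
  proof -
    have "v + w \<in> ?L" using L vw by (rule int_vec.subspace_add)
    then have "\<forall>\<^sub>F k in at_top. F ((2 * k) *s p + (v + w)) = (2 * k) * F p + G (v + w)"
      by (rule mult) simp
    with G[OF vw(1)] G[OF vw(2)] have "\<forall>\<^sub>F k :: int in at_top. G (v + w) \<le> G v + G w"
    proof eventually_elim
      case (elim k)
      have "(2 * k) *s p + (v + w) = (k *s p + v) + (k *s p + w)"
        by (simp add: vec_eq_iff algebra_simps)
      then show ?case using elim FD(2)[of "k *s p + v" "k *s p + w"] by simp
    qed
    then show ?thesis by simp
  qed
  have hom: "G (c *s v) = c * G v" if v: "v \<in> ?L" and c: "c > 0" for c v
  proof -
    have "c *s v \<in> ?L" using L v by (rule int_vec.subspace_scale)
    then have "\<forall>\<^sub>F k in at_top. F ((c * k) *s p + c *s v) = (c * k) * F p + G (c *s v)"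
      using c by (rule mult)
    with G[OF v] have "\<forall>\<^sub>F k :: int in at_top. G (c *s v) = c * G v"
    proof eventually_elim
      case (elim k)
      have "(c * k) *s p + c *s v = c *s (k *s p + v)"
        by (simp add: vec_eq_iff algebra_simps)
      then show ?case using elim FD(4)[of "k *s p + v" c] c by (simp add: algebra_simps)
    qed
    then show ?thesis by simp
  qed
  have le: "G v \<le> F v" if v: "v \<in> D" for v
  proof -
    have "p + v \<in> D" using FD p v by blast
    then have "v \<in> ?L" by (auto simp: recession_span_def intro!: exI[of _ 1])
    from G[OF this] eventually_gt_at_top[of 0]
    have "\<forall>\<^sub>F k :: int in at_top. G v \<le> F v"
    proof eventually_elim
      case (elim k)
      then show ?case using FD(2)[of "k *s p" v] FD(3,4)[OF p, of k] v by simp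
    qed
    then show ?thesis by simp
  qed
  have lin: "G (c *s p) = c * F p" for c
  proof -
    have "p \<in> ?L"
      using FD(3)[OF p, of 2] by (auto simp: recession_span_def vec_eq_iff intro!: exI[of _ 1] FD p)
    then have "c *s p \<in> ?L" using L by (blast intro: int_vec.subspace_scale)
    from G[OF this] eventually_gt_at_top[of "\<bar>c\<bar>"]
    have "\<forall>\<^sub>F k :: int in at_top. G (c *s p) = c * F p"
    proof eventually_elim
      case (elim k)
      have "k *s p + c *s p = (k + c) *s p"
        by (simp add: vec_eq_iff algebra_simps)
      then show ?case using elim FD(4)[OF p, of "k + c"] by (simp add: algebra_simps)
    qed
    then show ?thesis by simp
  qed
  have "G p = F p" "G (- p) = - F p"
    using lin[of 1] lin[of "- 1"] by simp_all
  then show ?thesis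
    using add hom le L unfolding int_sublinear_on_def
    by (intro exI[of _ G]) (auto intro: int_vec.subspace_add int_vec.subspace_scale)
qed

section \<open>Linear minorants by iterated directional derivatives\<close>

text \<open>Once the domain is a group, differentiating no longer changes it, so the construction
  can be iterated.\<close>

lemma recession_span_subspace:
  assumes "int_vec.subspace L" "p \<in> L"
  shows "recession_span L p = L"
proof
  show "L \<subseteq> recession_span L p"
    using assms by (auto simp: recession_span_def intro!: exI[of _ 1] int_vec.subspace_add)
  show "recession_span L p \<subseteq> L"
  proof
    fix v assume "v \<in> recession_span L p"
    then obtain k where "k *s p + v \<in> L" by (auto simp: recession_span_def)
    then have "(k *s p + v) - k *s p \<in> L"
      using assms by (blast intro: int_vec.subspace_diff int_vec.subspace_scale)
    then show "v \<in> L" by simp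
  qed
qed

lemma int_sublinear_on_zero:
  assumes "int_sublinear_on L G" "0 \<in> L"
  shows "G 0 = 0"
  using int_sublinear_onD(4)[OF assms, of 2] by simp

text \<open>Passing to the directional derivative at \<open>q\<close> keeps the subgroup on which a sublinear
  function is linear and adds \<open>q\<close> to it.\<close>

lemma int_linear_minorant_on_subspace:
  fixes L :: "(int ^ 'm) set"
  assumes L: "int_vec.subspace L" and F: "int_sublinear_on L F"
  shows "\<exists>l. int_linear_on L l \<and> (\<forall>v\<in>L. l v \<le> F v) \<and> (\<forall>v\<in>L. F (- v) = - F v \<longrightarrow> l v = F v)"
proof -
  obtain Q where Q: "Q \<subseteq> L" "finite Q" and
    rank: "\<forall>B. int_vec.subspace B \<longrightarrow> Q \<subseteq> B \<longrightarrow> B \<subseteq> L \<longrightarrow>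
      (\<forall>k>0. \<forall>v\<in>L. k *s v \<in> B \<longrightarrow> v \<in> B) \<longrightarrow> B = L"
    using int_subspace_finite_rank[OF L] by blast
  have neg: "- v \<in> L" if "v \<in> L" for v
    using L that by (rule int_vec.subspace_neg)
  have "\<exists>G. int_sublinear_on L G \<and> (\<forall>v\<in>L. G v \<le> F v) \<and> (\<forall>q\<in>Q. G (- q) = - G q)"
    using Q(2,1)
  proof (induction Q rule: finite_induct)
    case empty
    then show ?case using F by blast
  next
    case (insert q Q)
    then obtain H where H: "int_sublinear_on L H" "\<And>v. v \<in> L \<Longrightarrow> H v \<le> F v"
      "\<And>q. q \<in> Q \<Longrightarrow> H (- q) = - H q"
      by auto
    have q: "q \<in> L" using insert.prems by simp
    have "\<exists>k>0. k *s q - v \<in> L" if "v \<in> L" for v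
      using L q that by (intro exI[of _ 1]) (simp add: int_vec.subspace_diff)
    from ex_int_directional_derivative[OF H(1) q this]
    obtain G where G: "int_sublinear_on L G" "\<And>v. v \<in> L \<Longrightarrow> G v \<le> H v"
      "G q = H q" "G (- q) = - H q"
      unfolding recession_span_subspace[OF L q] by blast
    \<comment> \<open>Linearity along earlier directions survives:
      \<open>0 \<le> G x + G (- x) \<le> H x + H (- x) = 0\<close>.\<close>
    have "G (- x) = - G x" if "x \<in> Q" for x
    proof -
      have x: "x \<in> L" "- x \<in> L" using that insert.prems neg by auto
      have "0 \<le> G x + G (- x)"
        using int_sublinear_onD(2)[OF G(1) x] int_sublinear_on_zero[OF G(1)] L
        by (simp add: int_vec.subspace_0)
      then show ?thesis using G(2)[OF x(1)] G(2)[OF x(2)] H(3)[OF that] by linarith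
    qed
    then show ?case
      using G H(2) by (intro exI[of _ G]) force
  qed
  then obtain G where G: "int_sublinear_on L G" "\<And>v. v \<in> L \<Longrightarrow> G v \<le> F v"
    "\<And>q. q \<in> Q \<Longrightarrow> G (- q) = - G q"
    by blast
  note GD = int_sublinear_onD[OF G(1)]
  have G0: "G 0 = 0" using int_sublinear_on_zero[OF G(1)] L int_vec.subspace_0 by blast
  have pos: "0 \<le> G v + G (- v)" if "v \<in> L" for v
    using GD(2)[OF that neg[OF that]] G0 by simp
  \<comment> \<open>On the set where \<open>G\<close> is odd, subadditivity becomes additivity. This
    set is a saturated subgroup of \<open>L\<close> containing \<open>Q\<close>, hence all of
    \<open>L\<close>.\<close>
  define B where "B = {v\<in>L. G (- v) = - G v}"
  have scale: "G (k *s v) = k * G v" if v: "v \<in> B" for k v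
  proof (cases k "0::int" rule: linorder_cases)
    case less
    have "G ((- k) *s (- v)) = (- k) * G (- v)"
      using GD(4)[of "- v" "- k"] neg v less by (simp add: B_def)
    moreover have "(- k) *s (- v) = k *s v" by (simp add: vec_eq_iff)
    ultimately show ?thesis using v by (simp add: B_def)
  next
    case equal
    then show ?thesis using G0 by simp
  next
    case greater
    then show ?thesis using GD(4) v by (auto simp: B_def)
  qed
  have add: "G (v + w) = G v + G w" if vw: "v \<in> B" "w \<in> B" for v w
  proof -
    have mem: "v \<in> L" "w \<in> L" "v + w \<in> L" using vw L by (auto simp: B_def int_vec.subspace_add)
    have "G (- v + - w) \<le> G (- v) + G (- w)" "G (v + w) \<le> G v + G w"
      using mem GD(2) neg by blast+
    moreover have "G (- v + - w) \<ge> - G (v + w)"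
      using pos[OF mem(3)] by simp
    ultimately show ?thesis using vw by (simp add: B_def)
  qed
  have "B = L"
  proof (rule rank[rule_format])
    show "B \<subseteq> L" "Q \<subseteq> B" using Q G(3) by (auto simp: B_def)
    show "int_vec.subspace B"
      unfolding int_vec.subspace_def
    proof (intro conjI ballI allI)
      show "0 \<in> B" using L G0 by (simp add: B_def int_vec.subspace_0)
      fix v w assume vw: "v \<in> B" "w \<in> B"
      have mem: "v \<in> L" "w \<in> L" "v + w \<in> L" using vw L by (auto simp: B_def int_vec.subspace_add)
      have "G (- v + - w) \<le> G (- v) + G (- w)" using mem GD(2) neg by blast
      then have "G (- (v + w)) \<le> - G (v + w)"
        using add[OF vw] vw by (simp add: B_def)
      then show "v + w \<in> B" using pos[OF mem(3)] mem by (simp add: B_def)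
    next
      fix k v assume v: "v \<in> B"
      have "k *s v \<in> L" using v L by (auto simp: B_def int_vec.subspace_scale)
      then show "k *s v \<in> B" using scale[OF v, of k] scale[OF v, of "- k"] by (simp add: B_def)
    qed
    show "v \<in> B" if "k > 0" "v \<in> L" "k *s v \<in> B" for k v
    proof -
      have "G (k *s (- v)) = - G (k *s v)" using that by (simp add: B_def)
      then have "k * G (- v) = k * (- G v)"
        using GD(4)[of v k] GD(4)[of "- v" k] neg[of v] that by simp
      then have "G (- v) = - G v" using that(1) by (metis mult_left_cancel less_irrefl)
      then show ?thesis using that by (simp add: B_def)
    qed
  qed
  have "int_linear_on L G"
    using add scale \<open>B = L\<close> by (simp add: int_linear_on_def)
  \<comment> \<open>The bounds \<open>G v \<le> F v\<close> and \<open>G (- v) \<le> - F v\<close>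
    must both be equalities, because \<open>G v + G (- v)\<close> is nonnegative.\<close>
  moreover have "G v = F v" if "v \<in> L" "F (- v) = - F v" for v
    using G(2)[OF that(1)] G(2)[OF neg[OF that(1)]] pos[OF that(1)] that by linarith
  ultimately show ?thesis using G(2) by blast
qed

text \<open>The derivative at \<open>p\<close> carries \<open>F\<close> over to the group
  \<open>recession_span D p\<close>. A linear minorant of it keeps the value at \<open>p\<close>,
  where the derivative is odd, and saturation of the group gives it integer coefficients.\<close>

lemma int_sublinear_support:
  fixes D :: "(int ^ 'm) set"
  assumes F: "int_sublinear_on D F" and p: "p \<in> D"
    and unit: "\<And>v. v \<in> D \<Longrightarrow> \<exists>k>0. k *s p - v \<in> D"
    and sat: "\<And>k v. k > 0 \<Longrightarrow> k *s v \<in> D \<Longrightarrow> v \<in> D"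
  shows "\<exists>a. (\<forall>v\<in>D. int_dot a v \<le> F v) \<and> int_dot a p = F p"
proof -
  let ?L = "recession_span D p"
  have L: "int_vec.subspace ?L"
    by (rule subspace_recession_span[OF F p unit])
  have DL: "D \<subseteq> ?L"
    using int_sublinear_onD(1)[OF F] p by (auto simp: recession_span_def intro!: exI[of _ 1])
  obtain G where G: "int_sublinear_on ?L G" "\<And>v. v \<in> D \<Longrightarrow> G v \<le> F v" "G p = F p" "G (- p) = - F p"
    using ex_int_directional_derivative[OF F p unit] by blast
  obtain l where l: "int_linear_on ?L l" "\<And>v. v \<in> ?L \<Longrightarrow> l v \<le> G v"
    "\<And>v. v \<in> ?L \<Longrightarrow> G (- v) = - G v \<Longrightarrow> l v = G v"
    using int_linear_minorant_on_subspace[OF L G(1)] by blast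
  have "\<exists>a. \<forall>v\<in>?L. l v = int_dot a v"
  proof (rule int_linear_on_extend[OF L l(1)])
    fix k v assume kv: "k > 0" "k *s v \<in> ?L"
    show "v \<in> ?L" by (rule recession_span_saturated[OF F p _ kv]) (rule sat)
  qed
  then obtain a where a: "\<And>v. v \<in> ?L \<Longrightarrow> l v = int_dot a v"
    by blast
  have "int_dot a v \<le> F v" if "v \<in> D" for v
    using a l(2) G(2)[OF that] DL that by force
  moreover have "int_dot a p = F p"
    using a[of p] l(3)[of p] G DL p by auto
  ultimately show ?thesis by blast
qed

section \<open>Rational points of polyhedra\<close>

definition int_aff :: "int ^ 'n \<Rightarrow> int \<Rightarrow> real ^ 'n \<Rightarrow> real" where
  "int_aff a b x = (\<Sum>i\<in>UNIV. of_int (a $ i) * x $ i) + of_int b"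

lemma int_aff_inner: "int_aff a b x = (\<chi> i. of_int (a $ i)) \<bullet> x + of_int b"
  by (simp add: int_aff_def inner_vec_def)

lemma continuous_on_int_aff: "continuous_on S (int_aff a b)"
  unfolding int_aff_inner by (intro continuous_intros)

lemma int_aff_convex_combination:
  "u + v = 1 \<Longrightarrow> int_aff a b (u *\<^sub>R x + v *\<^sub>R y) = u * int_aff a b x + v * int_aff a b y"
  using distrib_right[of u v "of_int b :: real"] by (simp add: int_aff_inner inner_add_right algebra_simps)

lemma int_aff_reflect:
  "int_aff a b (2 *\<^sub>R x - y) = 2 * int_aff a b x - int_aff a b y"
  by (simp add: int_aff_inner inner_diff_right algebra_simps)

text \<open>By simultaneous Dirichlet approximation of \<open>x\<close> by \<open>p / q\<close>, each integer
  \<open>q * int_aff a b (p / q)\<close> has absolute value less than \<open>1\<close>.\<close>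

lemma rational_solution_approx:
  fixes x :: "real ^ 'n" and J :: "((int ^ 'n) \<times> int) set"
  assumes J: "finite J" "\<And>a b. (a, b) \<in> J \<Longrightarrow> int_aff a b x = 0" and e: "e > 0"
  shows "\<exists>y. (\<forall>i. y $ i \<in> \<rat>) \<and> dist y x < e \<and> (\<forall>(a, b)\<in>J. int_aff a b y = 0)"
proof -
  define s where "s = (\<Sum>(a, b)\<in>J. \<Sum>i\<in>UNIV. \<bar>of_int (a $ i) :: real\<bar>)"
  have s: "(\<Sum>i\<in>UNIV. \<bar>of_int (a $ i)\<bar>) \<le> s" if "(a, b) \<in> J" for a b
    unfolding s_def using member_le_sum[OF that, of "\<lambda>(a, b). \<Sum>i\<in>UNIV. \<bar>of_int (a $ i) :: real\<bar>"] J(1)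
    by (auto intro: sum_nonneg)
  have s0: "0 \<le> s" unfolding s_def by (auto intro!: sum_nonneg)
  \<comment> \<open>\<open>N > s\<close> makes the integers \<open>z\<close> below smaller than 1 in
    absolute value; \<open>N > CARD('n) / e\<close> makes the approximation \<open>e\<close>-close
    in the l1 norm.\<close>
  obtain N :: nat where N: "real N > s + 1 + real CARD('n) / e"
    using reals_Archimedean2 by blast
  have cn: "real CARD('n) / e \<ge> 0" using e by simp
  then have N0: "N > 0" "real N > s" "real CARD('n) / e < real N" using N s0 by linarith+
  obtain h where h: "bij_betw h {0..<CARD('n)} (UNIV :: 'n set)"
    using ex_bij_betw_nat_finite[of "UNIV :: 'n set"] by auto
  obtain q p where q: "0 < q" and
    pq: "\<And>i. i < CARD('n) \<Longrightarrow> \<bar>of_int q * (x $ h i) - of_int (p i)\<bar> < 1 / N"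
    using Dirichlet_approx_simult[OF N0(1), of "CARD('n)" "\<lambda>i. x $ h i"] by metis
  define r where "r i = p (inv_into {0..<CARD('n)} h i)" for i
  have r: "\<bar>of_int q * (x $ i) - of_int (r i)\<bar> < 1 / N" for i
  proof -
    have "inv_into {0..<CARD('n)} h i \<in> {0..<CARD('n)}" "h (inv_into {0..<CARD('n)} h i) = i"
      using h by (metis UNIV_I bij_betw_imp_surj_on inv_into_into, metis UNIV_I bij_betw_inv_into_right)
    then show ?thesis using pq[of "inv_into {0..<CARD('n)} h i"] by (simp add: r_def)
  qed
  define y where "y = ((\<chi> i. of_int (r i) / of_int q) :: real ^ 'n)"
  have yx: "\<bar>y $ i - x $ i\<bar> < 1 / N" for i
  proof -
    have "\<bar>y $ i - x $ i\<bar> = \<bar>of_int q * (x $ i) - of_int (r i)\<bar> / of_int q"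
      using q by (simp add: y_def field_simps abs_if)
    also have "\<dots> \<le> \<bar>of_int q * (x $ i) - of_int (r i)\<bar> / 1"
      using q by (intro divide_left_mono) auto
    finally show ?thesis using r[of i] by simp
  qed
  have "dist y x \<le> (\<Sum>i\<in>UNIV. \<bar>y $ i - x $ i\<bar>)"
    using norm_le_l1_cart[of "y - x"] by (simp add: dist_norm)
  also have "\<dots> \<le> (\<Sum>i\<in>(UNIV :: 'n set). 1 / N)"
    by (intro sum_mono less_imp_le yx)
  also have "\<dots> = real CARD('n) / N" by simp
  also have "\<dots> < e" using N0 e by (simp add: field_simps)
  finally have "dist y x < e" .
  moreover have "int_aff a b y = 0" if ab: "(a, b) \<in> J" for a b
  proof -
    define z where "z = (\<Sum>i\<in>UNIV. a $ i * r i) + b * q"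
    have zy: "of_int z = of_int q * int_aff a b y"
      using q by (simp add: z_def int_aff_def y_def distrib_left sum_distrib_left)
    have "of_int z = of_int q * int_aff a b y - of_int q * int_aff a b x"
      using zy J(2)[OF ab] by simp
    also have "\<dots> = (\<Sum>i\<in>UNIV. of_int (a $ i) * (of_int (r i) - of_int q * x $ i))"
      using q by (simp add: int_aff_def y_def algebra_simps sum_distrib_left sum_subtractf)
    finally have z: "of_int z = (\<Sum>i\<in>UNIV. of_int (a $ i) * (of_int (r i) - of_int q * x $ i))" .
    have "\<bar>of_int z :: real\<bar> \<le> (\<Sum>i\<in>UNIV. \<bar>of_int (a $ i)\<bar> * (1 / N))"
      unfolding z
    proof (intro order.trans[OF sum_abs] sum_mono)
      fix i show "\<bar>of_int (a $ i) * (of_int (r i) - of_int q * x $ i)\<bar> \<le> \<bar>of_int (a $ i)\<bar> * (1 / N)"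
        unfolding abs_mult using r[of i] by (intro mult_left_mono) (auto simp: abs_minus_commute)
    qed
    also have "\<dots> = (\<Sum>i\<in>UNIV. \<bar>of_int (a $ i)\<bar>) / N"
      by (simp add: sum_divide_distrib)
    also have "\<dots> \<le> s / N" by (intro divide_right_mono s[OF ab]) simp
    also have "\<dots> < 1" using N0 by simp
    finally have "z = 0" by linarith
    then show ?thesis using zy q by simp
  qed
  moreover have "\<forall>i. y $ i \<in> \<rat>" by (simp add: y_def)
  ultimately show ?thesis by blast
qed

definition int_polyhedron :: "((int ^ 'n) \<times> int) set \<Rightarrow> (real ^ 'n) set" where
  "int_polyhedron A = {x. \<forall>(a, b)\<in>A. int_aff a b x \<le> 0}"

lemma closed_int_polyhedron: "closed (int_polyhedron A)"
proof -
  have "int_polyhedron A = (\<Inter>(a, b)\<in>A. {x. int_aff a b x \<le> 0})"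
    by (auto simp: int_polyhedron_def)
  moreover have "closed {x. int_aff a b x \<le> 0}" for a b
    by (intro closed_Collect_le continuous_on_int_aff continuous_on_const)
  ultimately show ?thesis by (auto intro!: closed_INT)
qed

lemma polyhedron_int_polyhedron:
  assumes "finite A" "\<And>a b. (a, b) \<in> A \<Longrightarrow> a \<noteq> 0"
  shows "polyhedron (int_polyhedron A)"
proof -
  define H :: "(int ^ 'a) \<times> int \<Rightarrow> (real ^ 'a) set" where
    "H = (\<lambda>(a, b). {x. (\<chi> i. of_int (a $ i)) \<bullet> x \<le> - of_int b})"
  have "int_polyhedron A = \<Inter>(H ` A)"
    by (auto simp: int_polyhedron_def int_aff_inner H_def algebra_simps)
  moreover have "\<exists>a b. a \<noteq> 0 \<and> H ab = {x. a \<bullet> x \<le> b}" if "ab \<in> A" for ab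
  proof -
    obtain a b where ab: "ab = (a, b)" by fastforce
    then have "(\<chi> i. of_int (a $ i)) \<noteq> (0 :: real ^ 'a)"
      using assms(2)[of a b] that by (auto simp: vec_eq_iff)
    then show ?thesis by (auto simp: ab H_def)
  qed
  ultimately show ?thesis
    unfolding polyhedron_def using assms(1) by (intro exI[of _ "H ` A"]) auto
qed

text \<open>The constraints active at \<open>x\<close> are solved exactly by a rational
  \<open>y\<close>, and the others stay strict near \<open>x\<close>. The reflection of
  \<open>y\<close> in \<open>x\<close> has both properties too, which is what makes vertices
  rational.\<close>

lemma int_polyhedron_rational_approx:
  assumes A: "finite A" and x: "x \<in> int_polyhedron A" and e: "e > 0"
  shows "\<exists>y. (\<forall>i. y $ i \<in> \<rat>) \<and> dist y x < e \<and> y \<in> int_polyhedron A \<and>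
    2 *\<^sub>R x - y \<in> int_polyhedron A"
proof -
  define J where "J = {(a, b)\<in>A. int_aff a b x = 0}"
  define U where "U = (\<Inter>(a, b)\<in>A - J. {y. int_aff a b y < 0})"
  have "open {y. int_aff a b y < 0}" for a b
    by (intro open_Collect_less continuous_on_int_aff continuous_on_const)
  then have "open U"
    unfolding U_def using A by (intro open_INT) auto
  moreover have "x \<in> U"
    using x by (force simp: U_def J_def int_polyhedron_def)
  ultimately obtain d where d: "d > 0" "ball x d \<subseteq> U"
    using open_contains_ball by blast
  have "finite J" by (rule finite_subset[OF _ A]) (auto simp: J_def)
  moreover have J: "int_aff a b x = 0" if "(a, b) \<in> J" for a b
    using that by (simp add: J_def)
  moreover have "min d e > 0" using d e by simp
  ultimately have "\<exists>y. (\<forall>i. y $ i \<in> \<rat>) \<and> dist y x < min d e \<and> (\<forall>(a, b)\<in>J. int_aff a b y = 0)"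
    by (rule rational_solution_approx)
  then obtain y where y: "\<forall>i. y $ i \<in> \<rat>" "dist y x < min d e"
      "\<And>a b. (a, b) \<in> J \<Longrightarrow> int_aff a b y = 0"
    by blast
  have "dist (2 *\<^sub>R x - y) x = dist y x"
    by (simp add: dist_norm scaleR_2 norm_minus_commute)
  then have "y \<in> U" "2 *\<^sub>R x - y \<in> U"
    using d y(2) by (auto simp: subset_iff dist_commute)
  moreover have "z \<in> int_polyhedron A"
    if "z \<in> U" "\<And>a b. (a, b) \<in> J \<Longrightarrow> int_aff a b z = 0" for z
    unfolding int_polyhedron_def
  proof clarify
    fix a b assume "(a, b) \<in> A"
    then show "int_aff a b z \<le> 0"
      using that by (cases "(a, b) \<in> J") (force simp: U_def)+
  qed
  ultimately have "y \<in> int_polyhedron A" "2 *\<^sub>R x - y \<in> int_polyhedron A"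
    using y(3) J by (simp_all add: int_aff_reflect)
  then show ?thesis using y by auto
qed

text \<open>\<open>x\<close> is the midpoint of a rational point \<open>y\<close> of the polyhedron
  and its reflection, which also belongs to it; extremality forces \<open>y = x\<close>.\<close>

lemma extreme_point_of_int_polyhedron_rational:
  assumes A: "finite A" and x: "x extreme_point_of int_polyhedron A"
  shows "x $ i \<in> \<rat>"
proof -
  have "x \<in> int_polyhedron A" using x by (simp add: extreme_point_of_def)
  then obtain y where y: "\<forall>i. y $ i \<in> \<rat>" "y \<in> int_polyhedron A" "2 *\<^sub>R x - y \<in> int_polyhedron A"
    using int_polyhedron_rational_approx[OF A, of x 1] by auto
  have "x = midpoint y (2 *\<^sub>R x - y)"
    by (simp add: midpoint_def)
  moreover have "x \<notin> open_segment y (2 *\<^sub>R x - y)"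
    using x y by (simp add: extreme_point_of_def)
  ultimately have "y = 2 *\<^sub>R x - y"
    by (metis midpoint_in_open_segment)
  then have "x = y"
    by (simp add: vec_eq_iff)
  then show ?thesis using y by simp
qed

text \<open>A point of the polyhedron close to a relative interior point is itself relatively
  interior, so rational approximants can be taken there; the relative interior is dense in a closed
  convex set.\<close>

lemma rational_dense_rel_interior_int_polyhedron:
  assumes A: "finite A" and conv: "convex (int_polyhedron A)"
  shows "closure {x \<in> rel_interior (int_polyhedron A). \<forall>i. x $ i \<in> \<rat>} = int_polyhedron A"
    (is "closure ?R = ?C")
proof
  show "closure ?R \<subseteq> ?C"
    using rel_interior_subset by (intro closure_minimal closed_int_polyhedron) blast
  have "rel_interior ?C \<subseteq> closure ?R"
  proof
    fix x assume x: "x \<in> rel_interior ?C"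
    obtain d where d: "d > 0" "ball x d \<inter> affine hull ?C \<subseteq> rel_interior ?C"
      using x openin_rel_interior[of ?C] unfolding openin_contains_ball by blast
    show "x \<in> closure ?R"
      unfolding closure_approachable
    proof (intro allI impI)
      fix e :: real assume "e > 0"
      moreover have "x \<in> ?C" using x rel_interior_subset by blast
      ultimately obtain y where y: "\<forall>i. y $ i \<in> \<rat>" "dist y x < min d e" "y \<in> ?C"
        using int_polyhedron_rational_approx[OF A, of x "min d e"] d by auto
      then have "y \<in> ball x d \<inter> affine hull ?C"
        by (simp add: dist_commute hull_inc)
      then show "\<exists>y\<in>?R. dist y x < e" using d y by auto
    qed
  qed
  then have "closure (rel_interior ?C) \<subseteq> closure ?R"
    by (rule closure_minimal) simp
  then show "?C \<subseteq> closure ?R"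
    using convex_closure_rel_interior[OF conv] closed_int_polyhedron[of A] by simp
qed

lemma common_denominator:
  fixes S :: "real set"
  assumes "finite S" "S \<subseteq> \<rat>"
  shows "\<exists>q::int. q > 0 \<and> (\<forall>s\<in>S. of_int q * s \<in> \<int>)"
  using assms
proof (induction S rule: finite_induct)
  case empty
  show ?case by (intro exI[of _ 1]) simp
next
  case (insert r S)
  then obtain q :: int where q: "q > 0" "\<And>s. s \<in> S \<Longrightarrow> of_int q * s \<in> \<int>"
    by auto
  obtain m n :: int where r: "n > 0" "r = of_int m / of_int n"
    using insert.prems by (auto elim: Rats_cases')
  have "of_int (q * n) * s \<in> \<int>" if "s \<in> insert r S" for s
  proof (cases "s = r")
    case True
    then have "of_int (q * n) * s = of_int (q * m)" using r by simp
    then show ?thesis by (simp only: Ints_of_int)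
  next
    case False
    then have "of_int n * (of_int q * s) \<in> \<int>"
      using that by (intro Ints_mult[OF Ints_of_int q(2)]) auto
    then show ?thesis by (simp add: mult_ac)
  qed
  moreover have "q * n > 0" using q r by simp
  ultimately show ?case by blast
qed

section \<open>Supporting functionals at rational points\<close>

text \<open>\<open>None\<close> is the extra, homogenizing coordinate: it holds a common
  denominator, not necessarily the least one.\<close>

definition dehomogenize :: "int ^ ('n::finite option) \<Rightarrow> real ^ 'n" where
  "dehomogenize z = (\<chi> i. of_int (z $ Some i) / of_int (z $ None))"

text \<open>Homogenization turns an integral affine functional into an integer linear one, with the
  constant term as the \<open>None\<close> coefficient.\<close>

lemma int_dot_dehomogenize:
  fixes a z :: "int ^ ('n::finite option)"
  assumes "z $ None > 0"
  shows "of_int (int_dot a z) =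
    of_int (z $ None) * int_aff (\<chi> i. a $ Some i) (a $ None) (dehomogenize z)"
proof -
  have "int_dot a z = a $ None * z $ None + (\<Sum>i\<in>UNIV. a $ Some i * z $ Some i)"
    by (simp add: int_dot_def UNIV_option_conv sum.reindex)
  then show ?thesis
    using assms by (simp add: int_aff_def dehomogenize_def distrib_left sum_distrib_left)
qed

lemma dehomogenize_rational: "dehomogenize z $ i \<in> \<rat>"
  by (simp add: dehomogenize_def)

lemma dehomogenize_surj_rational:
  fixes x :: "real ^ 'n"
  assumes "\<forall>i. x $ i \<in> \<rat>"
  shows "\<exists>z. z $ None > 0 \<and> dehomogenize z = x"
proof -
  have "range (($) x) \<subseteq> \<rat>" using assms by auto
  then obtain q :: int where q: "q > 0" "\<And>i. of_int q * x $ i \<in> \<int>"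
    using common_denominator[of "range (($) x)"] by auto
  define z :: "int ^ ('n::finite option)" where
    "z = (\<chi> j. case j of None \<Rightarrow> q | Some i \<Rightarrow> \<lfloor>of_int q * x $ i\<rfloor>)"
  have "dehomogenize z = x"
    using q by (simp add: dehomogenize_def z_def vec_eq_iff field_simps)
  then show ?thesis using q by (intro exI[of _ z]) (simp add: z_def)
qed

lemma dehomogenize_add:
  assumes "z $ None > 0" "w $ None > 0"
  shows "dehomogenize (z + w) =
    (of_int (z $ None) / of_int (z $ None + w $ None)) *\<^sub>R dehomogenize z +
    (of_int (w $ None) / of_int (z $ None + w $ None)) *\<^sub>R dehomogenize w"
  using assms by (simp add: dehomogenize_def vec_eq_iff add_divide_distrib)

lemma dehomogenize_diff:
  assumes "z $ None > w $ None" "w $ None > 0"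
  shows "dehomogenize (z - w) =
    (of_int (z $ None) / of_int (z $ None - w $ None)) *\<^sub>R dehomogenize z -
    (of_int (w $ None) / of_int (z $ None - w $ None)) *\<^sub>R dehomogenize w"
  using assms by (simp add: dehomogenize_def vec_eq_iff diff_divide_distrib)

lemma dehomogenize_scale:
  "k > 0 \<Longrightarrow> dehomogenize (k *s z) = dehomogenize z"
  by (simp add: dehomogenize_def vec_eq_iff)

text \<open>\<open>int_sublinear_support\<close> is applied to the cone \<open>D\<close> over
  \<open>C\<close> and the homogenization \<open>F\<close> of \<open>f\<close>. A lattice point over
  a relative interior point is an order unit of \<open>D\<close>.\<close>

lemma rational_rel_interior_int_aff_support:
  fixes f :: "real ^ 'n \<Rightarrow> real"
  assumes f: "convex_on C f"
    and int: "\<And>x. x \<in> C \<Longrightarrow> \<forall>i. x $ i \<in> \<rat> \<Longrightarrow> \<exists>a b. f x = int_aff a b x"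
    and x: "x \<in> rel_interior C" "\<forall>i. x $ i \<in> \<rat>"
  shows "\<exists>a b. int_aff a b x = f x \<and> (\<forall>y\<in>C. (\<forall>i. y $ i \<in> \<rat>) \<longrightarrow> int_aff a b y \<le> f y)"
proof -
  have C: "convex C" using f by (rule convex_on_imp_convex)
  define D where "D = {z. z $ None > 0 \<and> dehomogenize z \<in> C}"
  \<comment> \<open>The floor only produces the type \<open>int\<close>; on \<open>D\<close> the
    product is already an integer.\<close>
  define F where "F z = \<lfloor>of_int (z $ None) * f (dehomogenize z)\<rfloor>" for z
  have F: "of_int (F z) = of_int (z $ None) * f (dehomogenize z)" if z: "z \<in> D" for z
  proof -
    obtain a b where ab: "f (dehomogenize z) = int_aff a b (dehomogenize z)"
      using int[of "dehomogenize z"] z dehomogenize_rational by (auto simp: D_def)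
    define c :: "int ^ ('n::finite option)" where
      "c = (\<chi> j. case j of None \<Rightarrow> b | Some i \<Rightarrow> a $ i)"
    have "of_int (z $ None) * f (dehomogenize z) = of_int (int_dot c z)"
      using z by (simp add: ab int_dot_dehomogenize D_def c_def)
    then show ?thesis by (simp add: F_def)
  qed
  obtain p where p: "p $ None > 0" "dehomogenize p = x"
    using dehomogenize_surj_rational[OF x(2)] by blast
  then have pD: "p \<in> D" using x(1) rel_interior_subset by (auto simp: D_def)
  have scale: "k *s z \<in> D \<longleftrightarrow> z \<in> D" if "k > 0" for k z
    using that by (simp add: D_def dehomogenize_scale zero_less_mult_iff)
  have "int_sublinear_on D F"
    unfolding int_sublinear_on_def
  proof (intro conjI ballI allI impI)
    fix z w assume zw: "z \<in> D" "w \<in> D"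
    define u v where "u = of_int (z $ None) / (of_int (z $ None + w $ None) :: real)"
      and "v = of_int (w $ None) / (of_int (z $ None + w $ None) :: real)"
    have pos: "z $ None > 0" "w $ None > 0" using zw by (auto simp: D_def)
    have uv: "u \<ge> 0" "v \<ge> 0" "u + v = 1"
      using pos by (auto simp: u_def v_def simp flip: add_divide_distrib)
    have add: "dehomogenize (z + w) = u *\<^sub>R dehomogenize z + v *\<^sub>R dehomogenize w"
      unfolding u_def v_def by (rule dehomogenize_add[OF pos])
    have mem: "dehomogenize z \<in> C" "dehomogenize w \<in> C" using zw by (auto simp: D_def)
    show zwD: "z + w \<in> D"
      using pos convexD[OF C mem uv] by (simp add: D_def add)
    have "f (dehomogenize (z + w)) \<le> u * f (dehomogenize z) + v * f (dehomogenize w)"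
      using f mem uv unfolding add convex_on_def by blast
    then have "of_int (z $ None + w $ None) * f (dehomogenize (z + w)) \<le>
      of_int (z $ None + w $ None) * (u * f (dehomogenize z) + v * f (dehomogenize w))"
      using pos by (intro mult_left_mono) auto
    also have "\<dots> = of_int (z $ None) * f (dehomogenize z) + of_int (w $ None) * f (dehomogenize w)"
      using pos by (simp add: u_def v_def distrib_left)
    finally have "real_of_int (F (z + w)) \<le> of_int (F z) + of_int (F w)"
      using F[OF zwD] F[OF zw(1)] F[OF zw(2)] by simp
    then show "F (z + w) \<le> F z + F w" by linarith
  next
    fix z :: "int ^ ('n option)" and k :: int assume z: "z \<in> D" and k: "k > 0"
    then show kD: "k *s z \<in> D" by (simp add: scale)
    have "real_of_int (F (k *s z)) = of_int (k * F z)"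
      using F[OF kD] F[OF z] k by (simp add: dehomogenize_scale)
    then show "F (k *s z) = k * F z" by linarith
  qed
  moreover have "\<exists>k>0. k *s p - w \<in> D" if w: "w \<in> D" for w
  proof -
    let ?W = "dehomogenize w"
    have W: "?W \<in> C" "w $ None > 0" using w by (auto simp: D_def)
    \<comment> \<open>The segment from \<open>?W\<close> to \<open>x\<close> can be prolonged beyond
      \<open>x\<close> inside \<open>C\<close>. The point below \<open>k *s p - w\<close> lies on
      this prolongation and tends to \<open>x\<close> as \<open>k\<close> grows.\<close>
    obtain e where e: "e > 1" "(1 - e) *\<^sub>R ?W + e *\<^sub>R x \<in> C"
      using x(1) W(1) convex_rel_interior_iff[OF C, of x] by blast
    \<comment> \<open>This bound, with \<open>p $ None \<ge> 1\<close>, yields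
      \<open>e * (P - w $ None) > P\<close>, that is, \<open>t < e\<close> for the position
      \<open>t\<close> on the prolongation.\<close>
    obtain k :: int where k: "k > e * of_int (w $ None) / (e - 1)"
      using ex_less_of_int by blast
    have "0 < e * of_int (w $ None) / (e - 1)" using e W by simp
    then have k0: "k > 0" using k by linarith
    define P where "P = real_of_int (k * p $ None)"
    have "real_of_int k \<le> P"
      using p k0 unfolding P_def by (simp add: mult_le_cancel_left1)
    then have "P > e * of_int (w $ None) / (e - 1)" using k by linarith
    then have P: "(e - 1) * P > e * of_int (w $ None)" using e by (simp add: field_simps)
    then have eP: "e * (P - of_int (w $ None)) > P" by (simp add: algebra_simps)
    have "P > 0" using k0 p by (simp add: P_def)
    then have PW: "P - of_int (w $ None) > 0" using eP e by (smt (verit) mult_pos_pos zero_less_mult_pos)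
    define t where "t = P / (P - of_int (w $ None))"
    have t: "1 < t" "t \<le> e" using PW W eP by (auto simp: t_def field_simps)
    define s where "s = (t - 1) / (e - 1)"
    have s: "0 \<le> s" "s \<le> 1" "s * (e - 1) = t - 1" using t e by (auto simp: s_def)
    have lt: "(k *s p) $ None > w $ None"
      using PW unfolding P_def by (simp flip: of_int_mult)
    have "of_int (w $ None) / (P - of_int (w $ None)) = t - 1"
      using PW by (simp add: t_def field_simps)
    then have "dehomogenize (k *s p - w) = t *\<^sub>R x - (t - 1) *\<^sub>R ?W"
      using dehomogenize_diff[OF lt W(2)] k0 p by (simp add: dehomogenize_scale t_def P_def)
    also have "\<dots> = (1 + s * (e - 1)) *\<^sub>R x - (s * (e - 1)) *\<^sub>R ?W"
      by (simp add: s)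
    also have "\<dots> = (1 - s) *\<^sub>R x + s *\<^sub>R ((1 - e) *\<^sub>R ?W + e *\<^sub>R x)"
      by (simp add: algebra_simps)
    also have "\<dots> \<in> C"
    proof (rule convexD[OF C _ e(2)])
      show "x \<in> C" using x(1) rel_interior_subset by blast
    qed (use s in auto)
    finally have "k *s p - w \<in> D" using lt by (simp add: D_def)
    then show ?thesis using k0 by blast
  qed
  ultimately obtain c where c: "\<And>z. z \<in> D \<Longrightarrow> int_dot c z \<le> F z" "int_dot c p = F p"
    using int_sublinear_support[of D F p] pD scale by blast
  let ?l = "int_aff (\<chi> i. c $ Some i) (c $ None)"
  have val: "of_int (z $ None) * ?l (dehomogenize z) = of_int (int_dot c z)" if "z \<in> D" for z
    using that by (simp add: D_def int_dot_dehomogenize)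
  have "?l y \<le> f y" if y: "y \<in> C" "\<forall>i. y $ i \<in> \<rat>" for y
  proof -
    obtain z where z: "z $ None > 0" "dehomogenize z = y"
      using dehomogenize_surj_rational[OF y(2)] by blast
    then have "z \<in> D" using y by (simp add: D_def)
    then have "of_int (z $ None) * ?l y \<le> of_int (z $ None) * f y"
      using val[of z] F[of z] c(1)[of z] z by simp
    then show ?thesis using z by simp
  qed
  moreover have "?l x = f x"
    using val[OF pD] F[OF pD] c(2) p by simp
  ultimately show ?thesis by blast
qed

section \<open>Finiteness\<close>

text \<open>Dickson's lemma, by induction on the coordinates. Minorants \<open>Y\<close> for the old
  coordinates also work when the new coordinate is at least the bound \<open>m\<close> of its values
  on \<open>Y\<close>; each of the finitely many slices below \<open>m\<close> is handled by the
  induction hypothesis.\<close>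

lemma dickson_finite_minorants:
  fixes X :: "('v \<Rightarrow> nat) set"
  assumes "finite V"
  shows "\<exists>Y\<subseteq>X. finite Y \<and> (\<forall>x\<in>X. \<exists>y\<in>Y. \<forall>v\<in>V. y v \<le> x v)"
  using assms
proof (induction V arbitrary: X rule: finite_induct)
  case empty
  show ?case
  proof (cases "X = {}")
    case False
    then obtain x where "x \<in> X" by blast
    then show ?thesis by (intro exI[of _ "{x}"]) auto
  qed auto
next
  case (insert u V)
  obtain Y where Y: "Y \<subseteq> X" "finite Y" "\<And>x. x \<in> X \<Longrightarrow> \<exists>y\<in>Y. \<forall>v\<in>V. y v \<le> x v"
    using insert.IH[of X] by blast
  obtain m where m: "\<And>y. y \<in> Y \<Longrightarrow> y u < m"
    using finite_nat_set_iff_bounded[of "(\<lambda>y. y u) ` Y"] Y(2) by auto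
  have "\<forall>j. \<exists>Z\<subseteq>{x\<in>X. x u = j}. finite Z \<and>
      (\<forall>x\<in>{x\<in>X. x u = j}. \<exists>y\<in>Z. \<forall>v\<in>V. y v \<le> x v)"
    using insert.IH by blast
  from choice[OF this] obtain Z where
    "\<forall>j. Z j \<subseteq> {x\<in>X. x u = j} \<and> finite (Z j) \<and>
      (\<forall>x\<in>{x\<in>X. x u = j}. \<exists>y\<in>Z j. \<forall>v\<in>V. y v \<le> x v)" ..
  then have Z: "\<And>j. Z j \<subseteq> {x\<in>X. x u = j}" "\<And>j. finite (Z j)"
       "\<And>j x. x \<in> X \<Longrightarrow> x u = j \<Longrightarrow> \<exists>y\<in>Z j. \<forall>v\<in>V. y v \<le> x v"
    by simp_all
  have "\<exists>y\<in>Y \<union> (\<Union>j<m. Z j). \<forall>v\<in>insert u V. y v \<le> x v" if x: "x \<in> X" for x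
  proof (cases "x u < m")
    case True
    obtain y where y: "y \<in> Z (x u)" "\<forall>v\<in>V. y v \<le> x v"
      using Z(3)[OF x refl] by blast
    then have "y u = x u" using Z(1) by auto
    then show ?thesis using y True by (intro bexI[of _ y]) auto
  next
    case False
    obtain y where y: "y \<in> Y" "\<forall>v\<in>V. y v \<le> x v"
      using Y(3)[OF x] by blast
    then show ?thesis using m[OF y(1)] False by (intro bexI[of _ y]) auto
  qed
  moreover have "Y \<union> (\<Union>j<m. Z j) \<subseteq> X" "finite (Y \<union> (\<Union>j<m. Z j))"
    using Y(1,2) Z(1,2) by (blast, simp)
  ultimately show ?case by blast
qed

text \<open>The values of integral affine functionals at the points of \<open>V\<close> lie in a common lattice, so
  that Dickson's lemma applies to their distances from the upper bound \<open>g\<close>.\<close>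

lemma finite_dominating_int_aff:
  fixes V :: "(real ^ 'n) set" and S :: "((int ^ 'n) \<times> int) set"
  assumes V: "finite V" "\<And>v i. v \<in> V \<Longrightarrow> v $ i \<in> \<rat>"
    and bound: "\<And>a b v. (a, b) \<in> S \<Longrightarrow> v \<in> V \<Longrightarrow> int_aff a b v \<le> g v"
  shows "\<exists>T\<subseteq>S. finite T \<and>
    (\<forall>(a, b)\<in>S. \<exists>(c, d)\<in>T. \<forall>x\<in>convex hull V. int_aff a b x \<le> int_aff c d x)"
proof -
  have "(\<Union>v\<in>V. range (($) v)) \<subseteq> \<rat>" "finite (\<Union>v\<in>V. range (($) v))"
    using V by auto
  then obtain q :: int where q: "q > 0" "\<And>v i. v \<in> V \<Longrightarrow> of_int q * v $ i \<in> \<int>"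
    using common_denominator[of "\<Union>v\<in>V. range (($) v)"] by auto
  have int: "of_int q * int_aff a b v \<in> \<int>" if "v \<in> V" for a b v
  proof -
    have "of_int q * int_aff a b v = (\<Sum>i\<in>UNIV. of_int (a $ i) * (of_int q * v $ i)) + of_int (q * b)"
      by (simp add: int_aff_def distrib_left sum_distrib_left mult_ac)
    also have "\<dots> \<in> \<int>"
      by (intro Ints_add Ints_sum Ints_of_int Ints_mult[OF Ints_of_int q(2)[OF that]])
    finally show ?thesis .
  qed
  \<comment> \<open>The distance below \<open>g\<close> at each point of \<open>V\<close>, counted
    in units of \<open>1 / q\<close>; a smaller distance means a larger functional.\<close>
  define m where "m = (\<lambda>(a, b) v. nat (\<lfloor>of_int q * g v\<rfloor> - \<lfloor>of_int q * int_aff a b v\<rfloor>))"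
  have m: "int_aff a b v \<le> int_aff c d v"
    if "m (c, d) v \<le> m (a, b) v" "(a, b) \<in> S" "(c, d) \<in> S" "v \<in> V" for a b c d v
  proof -
    have "\<lfloor>of_int q * int_aff a b v\<rfloor> \<le> \<lfloor>of_int q * g v\<rfloor>" "\<lfloor>of_int q * int_aff c d v\<rfloor> \<le> \<lfloor>of_int q * g v\<rfloor>"
      using bound that q by (auto intro!: floor_mono)
    then have "\<lfloor>of_int q * int_aff a b v\<rfloor> \<le> \<lfloor>of_int q * int_aff c d v\<rfloor>"
      using that(1) by (simp add: m_def)
    then have "of_int q * int_aff a b v \<le> of_int q * int_aff c d v"
      using int[OF that(4)] by (metis of_int_floor of_int_le_iff)
    then show ?thesis using q by simp
  qed
  obtain Y where Y: "Y \<subseteq> m ` S" "finite Y" "\<And>x. x \<in> m ` S \<Longrightarrow> \<exists>y\<in>Y. \<forall>v\<in>V. y v \<le> x v"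
    using dickson_finite_minorants[OF V(1), of "m ` S"] by blast
  obtain T where T: "T \<subseteq> S" "finite T" "Y = m ` T"
    using finite_subset_image[OF Y(2,1)] by blast
  have "\<exists>(c, d)\<in>T. \<forall>x\<in>convex hull V. int_aff a b x \<le> int_aff c d x" if ab: "(a, b) \<in> S" for a b
  proof -
    obtain c d where cd: "(c, d) \<in> T" "\<And>v. v \<in> V \<Longrightarrow> m (c, d) v \<le> m (a, b) v"
      using Y(3)[of "m (a, b)"] ab T by fastforce
    have "convex {x. int_aff a b x \<le> int_aff c d x}"
      by (rule convexI) (auto simp: int_aff_convex_combination intro!: add_mono mult_left_mono)
    then have "convex hull V \<subseteq> {x. int_aff a b x \<le> int_aff c d x}"
      using m[OF cd(2) ab] cd(1) T(1) by (intro hull_minimal) auto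
    then show ?thesis using cd by blast
  qed
  then show ?thesis using T by (intro exI[of _ T]) auto
qed

section \<open>Translation between the definitions and finite integral systems\<close>

text \<open>Convexity of \<open>C\<close> is part of the conclusion: Jensen's inequality for the
  extension forces a finite value between two points of \<open>C\<close>.\<close>

lemma convex_fun_on_imp_convex_on:
  assumes f: "convex_fun_on C f"
  shows "convex_on C f"
proof -
  have *: "(1 - t) *\<^sub>R x + t *\<^sub>R y \<in> C \<and> f ((1 - t) *\<^sub>R x + t *\<^sub>R y) \<le> (1 - t) * f x + t * f y"
    if "0 < t" "t < 1" "x \<in> C" "y \<in> C" for t x y
  proof -
    have "extend_infty C f ((1 - t) *\<^sub>R x + t *\<^sub>R y) \<le>
        ereal (1 - t) * extend_infty C f x + ereal t * extend_infty C f y"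
      using f that unfolding convex_fun_on_def ereal_convex_def by blast
    also have "\<dots> = ereal ((1 - t) * f x + t * f y)"
      using that by (simp add: extend_infty_def)
    finally show ?thesis
      by (cases "(1 - t) *\<^sub>R x + t *\<^sub>R y \<in> C") (simp_all add: extend_infty_def)
  qed
  have "convex C"
    unfolding convex_alt
  proof (intro ballI allI impI)
    fix x y and u :: real assume "x \<in> C" "y \<in> C" "0 \<le> u \<and> u \<le> 1"
    then show "(1 - u) *\<^sub>R x + u *\<^sub>R y \<in> C"
      using *[of u x y] by (cases "u = 0 \<or> u = 1") auto
  qed
  with * show ?thesis by (intro convex_onI) auto
qed

text \<open>A finite maximum is infinite exactly when one of its terms is, and a generalized affine
  term is infinite exactly off its half-space, if it has one.\<close>

lemma rational_polyhedral_int_polyhedron: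
  fixes C :: "(real ^ 'n) set"
  assumes "rational_polyhedral C"
  shows "\<exists>A. finite A \<and> (\<forall>(a, b)\<in>A. a \<noteq> 0) \<and> C = int_polyhedron A"
proof -
  obtain G where G: "finite G" "G \<noteq> {}" "\<And>h. h \<in> G \<Longrightarrow> integral_gen_affine h"
    and max: "\<And>x. delta C x = (MAX h\<in>G. h x)"
    using assms unfolding rational_polyhedral_def integral_polyhedral_def by metis
  have "\<exists>A. finite A \<and> (\<forall>(a, b)\<in>A. a \<noteq> 0) \<and> (\<forall>x. h x = \<infinity> \<longleftrightarrow> x \<notin> int_polyhedron A)"
    if "h \<in> G" for h
    using G(3)[OF that] unfolding integral_gen_affine_def
  proof (elim disjE exE conjE)
    fix l assume "h = (\<lambda>x. ereal (l x))"
    then show ?thesis by (intro exI[of _ "{}"]) (simp add: int_polyhedron_def)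
  next
    fix l H assume H: "integral_half_space H" and h: "h = (\<lambda>x. ereal (l x) + delta H x)"
    obtain a b where "a \<noteq> 0" "H = {x. (\<Sum>i\<in>UNIV. of_int (a $ i) * x $ i) \<le> of_int b}"
      using H unfolding integral_half_space_def by blast
    then show ?thesis
      by (intro exI[of _ "{(a, - b)}"]) (auto simp: int_polyhedron_def int_aff_def h delta_def)
  qed
  then have "\<forall>h\<in>G. \<exists>A. finite A \<and> (\<forall>(a, b)\<in>A. a \<noteq> 0) \<and> (\<forall>x. h x = \<infinity> \<longleftrightarrow> x \<notin> int_polyhedron A)"
    by blast
  from bchoice[OF this] obtain A where
    "\<forall>h\<in>G. finite (A h) \<and> (\<forall>(a, b)\<in>A h. a \<noteq> 0) \<and> (\<forall>x. h x = \<infinity> \<longleftrightarrow> x \<notin> int_polyhedron (A h))" ..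
  then have A: "\<And>h. h \<in> G \<Longrightarrow> finite (A h)" "\<And>h a b. h \<in> G \<Longrightarrow> (a, b) \<in> A h \<Longrightarrow> a \<noteq> 0"
    "\<And>h x. h \<in> G \<Longrightarrow> h x = \<infinity> \<longleftrightarrow> x \<notin> int_polyhedron (A h)"
    by (blast, blast, simp)
  have "x \<in> C \<longleftrightarrow> x \<in> int_polyhedron (\<Union>h\<in>G. A h)" for x
  proof -
    have "x \<notin> C \<longleftrightarrow> (MAX h\<in>G. h x) = \<infinity>"
      using max[of x] by (auto simp: delta_def)
    also have "\<dots> \<longleftrightarrow> (\<exists>h\<in>G. h x = \<infinity>)"
    proof
      assume "(MAX h\<in>G. h x) = \<infinity>"
      moreover have "(MAX h\<in>G. h x) \<in> (\<lambda>h. h x) ` G"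
        using G by (intro Max_in) auto
      ultimately show "\<exists>h\<in>G. h x = \<infinity>"
        by (metis imageE)
    next
      assume "\<exists>h\<in>G. h x = \<infinity>"
      then obtain h where "h \<in> G" "h x = \<infinity>" by blast
      then show "(MAX h\<in>G. h x) = \<infinity>"
        using Max_ge[of "(\<lambda>h. h x) ` G" "h x"] G(1) by (metis finite_imageI image_eqI ereal_infty_less_eq(1))
    qed
    also have "\<dots> \<longleftrightarrow> (\<exists>h\<in>G. x \<notin> int_polyhedron (A h))"
      using A(3) by blast
    also have "\<dots> \<longleftrightarrow> x \<notin> int_polyhedron (\<Union>h\<in>G. A h)"
      by (auto simp: int_polyhedron_def)
    finally show ?thesis by blast
  qed
  then have "C = int_polyhedron (\<Union>h\<in>G. A h)" by blast
  moreover have "finite (\<Union>h\<in>G. A h)" using A(1) G(1) by simp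
  moreover have "\<forall>(a, b)\<in>(\<Union>h\<in>G. A h). a \<noteq> 0" using A(2) by blast
  ultimately show ?thesis by blast
qed

lemma integral_affine_int_aff: "integral_affine (int_aff a b)"
  unfolding integral_affine_def int_aff_def by blast

text \<open>Each constraint in \<open>A\<close> contributes its indicator added to one fixed member
  \<open>(a0, b0)\<close> of \<open>T\<close>. On the polyhedron such a term stays below
  \<open>f\<close>, and off it one of these terms is infinite.\<close>

lemma integral_polyhedral_onI:
  fixes A T :: "((int ^ 'n) \<times> int) set"
  assumes A: "finite A" "\<And>a b. (a, b) \<in> A \<Longrightarrow> a \<noteq> 0" and T: "finite T" "T \<noteq> {}"
    and le: "\<And>a b x. (a, b) \<in> T \<Longrightarrow> x \<in> int_polyhedron A \<Longrightarrow> int_aff a b x \<le> f x"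
    and eq: "\<And>x. x \<in> int_polyhedron A \<Longrightarrow> \<exists>(a, b)\<in>T. int_aff a b x = f x"
  shows "integral_polyhedral_on (int_polyhedron A) f"
proof -
  obtain a0 b0 where T0: "(a0, b0) \<in> T" using T by fastforce
  define G1 where "G1 = (\<lambda>(a, b) x. ereal (int_aff a b x)) ` T"
  define G2 where "G2 = (\<lambda>(a, b) x. ereal (int_aff a0 b0 x) + delta {x. int_aff a b x \<le> 0} x) ` A"
  let ?G = "G1 \<union> G2"
  have fin: "finite ?G" "?G \<noteq> {}" using A T by (auto simp: G1_def G2_def)
  have half: "integral_half_space {x. int_aff a b x \<le> 0}" if "(a, b) \<in> A" for a b
    unfolding integral_half_space_def
    by (rule exI[of _ a], rule exI[of _ "- b"]) (use A(2)[OF that] in \<open>auto simp: int_aff_def\<close>)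
  have gen: "integral_gen_affine h" if "h \<in> ?G" for h
    using that unfolding integral_gen_affine_def G1_def G2_def
    using integral_affine_int_aff half by fastforce
  have "extend_infty (int_polyhedron A) f x = (MAX h\<in>?G. h x)" for x
  proof (cases "x \<in> int_polyhedron A")
    case True
    obtain a b where ab: "(a, b) \<in> T" "int_aff a b x = f x" using eq[OF True] by blast
    have "(MAX h\<in>?G. h x) = ereal (f x)"
    proof (rule Max_eqI)
      have "(\<lambda>x. ereal (int_aff a b x)) \<in> ?G"
        using ab(1) by (force simp: G1_def)
      then show "ereal (f x) \<in> (\<lambda>h. h x) ` ?G"
        by (rule rev_image_eqI) (simp add: ab(2))
      show "y \<le> ereal (f x)" if "y \<in> (\<lambda>h. h x) ` ?G" for y
        using that le[OF _ True] T0 True by (auto simp: G1_def G2_def delta_def int_polyhedron_def)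
    qed (use fin in simp)
    then show ?thesis using True by (simp add: extend_infty_def)
  next
    case False
    then obtain a b where ab: "(a, b) \<in> A" "\<not> int_aff a b x \<le> 0"
      by (auto simp: int_polyhedron_def)
    have "(MAX h\<in>?G. h x) = \<infinity>"
    proof (rule Max_eqI)
      have "(\<lambda>x. ereal (int_aff a0 b0 x) + delta {x. int_aff a b x \<le> 0} x) \<in> ?G"
        using ab(1) by (force simp: G2_def)
      then show "\<infinity> \<in> (\<lambda>h. h x) ` ?G"
        by (rule rev_image_eqI) (use ab(2) in \<open>simp add: delta_def\<close>)
    qed (use fin in simp_all)
    then show ?thesis using False by (simp add: extend_infty_def)
  qed
  then show ?thesis
    unfolding integral_polyhedral_on_def integral_polyhedral_def
    using fin gen by (intro exI[of _ ?G]) auto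
qed

text \<open>The maximum at \<open>x\<close> is attained, and the attaining term is finite there, so
  it equals its affine part. This gives one direction of the equivalence.\<close>

lemma integral_polyhedral_on_imp_int_aff:
  assumes "integral_polyhedral_on C f" and x: "x \<in> C"
  shows "\<exists>a b. f x = int_aff a b x"
proof -
  obtain G where G: "finite G" "G \<noteq> {}" "\<And>h. h \<in> G \<Longrightarrow> integral_gen_affine h"
    and max: "\<And>x. extend_infty C f x = (MAX h\<in>G. h x)"
    using assms unfolding integral_polyhedral_on_def integral_polyhedral_def by metis
  have "(MAX h\<in>G. h x) \<in> (\<lambda>h. h x) ` G"
    using G by (intro Max_in) auto
  then obtain h where h: "h \<in> G" "h x = ereal (f x)"
    using max[of x] x by (auto simp: extend_infty_def)
  then have "\<exists>l. integral_affine l \<and> f x = l x"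
    using G(3)[OF h(1)] by (auto simp: integral_gen_affine_def delta_def split: if_splits)
  then show ?thesis
    by (auto simp: integral_affine_def int_aff_def)
qed

section \<open>From values at rational points to a finite maximum\<close>

lemma integral_polyhedral_onI_rational_values:
  fixes C :: "(real ^ 'n) set"
  assumes C: "rational_polyhedral C" "bounded C"
    and f: "continuous_on C f" "convex_on C f"
    and int: "\<And>x. x \<in> C \<Longrightarrow> \<forall>i. x $ i \<in> \<rat> \<Longrightarrow> \<exists>a b. f x = int_aff a b x"
  shows "integral_polyhedral_on C f"
proof -
  obtain A where A: "finite A" "\<And>a b. (a, b) \<in> A \<Longrightarrow> a \<noteq> 0" and CA: "C = int_polyhedron A"
    using rational_polyhedral_int_polyhedron[OF C(1)] by blast
  have closed: "closed C" using closed_int_polyhedron CA by blast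
  have conv: "convex C" using f(2) by (rule convex_on_imp_convex)
  define R where "R = {x \<in> rel_interior C. \<forall>i. x $ i \<in> \<rat>}"
  have R: "closure R = C"
    using rational_dense_rel_interior_int_polyhedron[OF A(1)] conv by (simp add: R_def CA)
  define V where "V = {v. v extreme_point_of C}"
  have V: "finite V" "\<And>v i. v \<in> V \<Longrightarrow> v $ i \<in> \<rat>" "V \<subseteq> C" "convex hull V = C"
  proof -
    show "finite V"
      unfolding V_def CA by (intro finite_polyhedron_extreme_points polyhedron_int_polyhedron A)
    show "v $ i \<in> \<rat>" if "v \<in> V" for v i
      using that extreme_point_of_int_polyhedron_rational[OF A(1)] by (simp add: V_def CA)
    show "V \<subseteq> C" by (auto simp: V_def extreme_point_of_def)
    show "convex hull V = C"
      using Krein_Milman_Minkowski[of C] closed C(2) conv by (simp add: V_def compact_eq_bounded_closed)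
  qed
  \<comment> \<open>All integral affine minorants of \<open>f\<close> on \<open>C\<close>. Their
    values at the vertices are bounded by \<open>f\<close>, so a finite \<open>T\<close> dominates
    them on \<open>C\<close>.\<close>
  define S where "S = {(a, b). \<forall>x\<in>C. int_aff a b x \<le> f x}"
  have "\<exists>T\<subseteq>S. finite T \<and>
      (\<forall>(a, b)\<in>S. \<exists>(c, d)\<in>T. \<forall>x\<in>convex hull V. int_aff a b x \<le> int_aff c d x)"
  proof (rule finite_dominating_int_aff[OF V(1)])
    show "v $ i \<in> \<rat>" if "v \<in> V" for v i using that by (rule V(2))
    show "int_aff a b v \<le> f v" if "(a, b) \<in> S" "v \<in> V" for a b v
      using that V(3) by (auto simp: S_def)
  qed
  then obtain T where T: "T \<subseteq> S" "finite T"
    "\<forall>(a, b)\<in>S. \<exists>(c, d)\<in>T. \<forall>x\<in>C. int_aff a b x \<le> int_aff c d x"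
    unfolding V(4) by (elim exE conjE)
  \<comment> \<open>These contact sets are closed by continuity of \<open>f\<close>. Finitely many
    of them cover the dense set \<open>R\<close>, hence all of \<open>C\<close>.\<close>
  define E where "E = (\<lambda>(a, b). {x\<in>C. int_aff a b x = f x})"
  have "R \<subseteq> (\<Union>t\<in>T. E t)"
  proof
    fix x assume x: "x \<in> R"
    obtain a b where ab: "int_aff a b x = f x"
      "\<And>y. y \<in> C \<Longrightarrow> \<forall>i. y $ i \<in> \<rat> \<Longrightarrow> int_aff a b y \<le> f y"
      using rational_rel_interior_int_aff_support[OF f(2) int, of x] x by (auto simp: R_def)
    \<comment> \<open>The support inequality is known at rational points only; density of
      \<open>R\<close> and continuity extend it to \<open>C\<close>.\<close>
    have "R \<subseteq> {y\<in>C. int_aff a b y \<le> f y}"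
      using ab(2) rel_interior_subset by (auto simp: R_def)
    then have "C \<subseteq> {y\<in>C. int_aff a b y \<le> f y}"
      unfolding R[symmetric] using closed R f(1)
      by (intro closure_minimal continuous_on_closed_Collect_le continuous_on_int_aff) auto
    then have "(a, b) \<in> S" by (auto simp: S_def)
    then obtain c d where cd: "(c, d) \<in> T" "\<And>x. x \<in> C \<Longrightarrow> int_aff a b x \<le> int_aff c d x"
      using T(3) by blast
    have "x \<in> C" using x rel_interior_subset by (auto simp: R_def)
    moreover have "int_aff c d x \<le> f x" using cd(1) T(1) \<open>x \<in> C\<close> by (auto simp: S_def)
    ultimately have "x \<in> E (c, d)" using cd(2)[of x] ab(1) by (simp add: E_def)
    then show "x \<in> (\<Union>t\<in>T. E t)" using cd(1) by blast
  qed
  moreover have "closed (E t)" for t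
  proof -
    obtain a b where "t = (a, b)" by fastforce
    moreover have "closed {x\<in>C. int_aff a b x - f x = 0}"
      by (intro continuous_closed_preimage_constant continuous_on_diff continuous_on_int_aff f(1) closed)
    ultimately show ?thesis by (simp add: E_def)
  qed
  ultimately have "C \<subseteq> (\<Union>t\<in>T. E t)"
    unfolding R[symmetric] using T(2) by (intro closure_minimal closed_UN) auto
  then have eq: "\<exists>(a, b)\<in>T. int_aff a b x = f x" if "x \<in> C" for x
    using that by (fastforce simp: E_def)
  show ?thesis
  proof (cases "C = {}")
    \<comment> \<open>Here \<open>T\<close> may be empty, so the zero functional serves as the
      required nonempty family.\<close>
    case True
    then show ?thesis
      unfolding CA by (intro integral_polyhedral_onI[where T = "{(0, 0)}"] A) auto
  next
    case False
    then have "T \<noteq> {}" using eq by blast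
    then show ?thesis
      using T(1) eq
      unfolding CA by (intro integral_polyhedral_onI[where T = T] A T(2)) (auto simp: S_def CA)
  qed
qed

theorem theorem2p16:
  fixes C :: "(real ^ 'n) set" and f :: "real ^ 'n \<Rightarrow> real"
  assumes "rational_polyhedral C" and "bounded C"
    and "continuous_on C f" and "convex_fun_on C f"
  shows "integral_polyhedral_on C f \<longleftrightarrow>
    (\<forall>x\<in>C. (\<forall>i. x $ i \<in> \<rat>) \<longrightarrow>
       f x \<in> {of_int b + (\<Sum>i\<in>UNIV. of_int (a $ i) * x $ i) | (b :: int) (a :: int ^ 'n). True})"
proof -
  have "f x \<in> {of_int b + (\<Sum>i\<in>UNIV. of_int (a $ i) * x $ i) | (b :: int) (a :: int ^ 'n). True}
      \<longleftrightarrow> (\<exists>a b. f x = int_aff a b x)" for x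
    by (auto simp: int_aff_def add.commute)
  then show ?thesis
    using integral_polyhedral_on_imp_int_aff
      integral_polyhedral_onI_rational_values[OF assms(1-3) convex_fun_on_imp_convex_on[OF assms(4)]]
    by blast
qed

end
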